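(* Let $k,l$ be non-zero integers and let $G=BS(k,l)=\langle a,t\mid ta^kt^{-1}=a^l\rangle$. The relative Dehn function $\Delta_{G,\langle t\rangle}$ is well-defined if and only if $k$ does not divide $l$ and $l$ does not divide $k$.
   Context: Let $H\le G$ be a subgroup (here $H=\langle t\rangle$). For $S\subseteq G$, $G$ is generated by $S$ relative to $H$ if the natural homomorphism $F=F(S)*H\to G$ is surjective. If $R\subseteq F$ normally generates the kernel, $G=\langle S,H\mid R\rangle$ is a relative presentation; it is finite if $S$ and $R$ are finite, and then $G$ is finitely presented relative to $H$. The relative Dehn function $\Delta_{G,H}$ of the relative presentation is the smallest function on $\mathbb{N}$ (value $\infty$ allowed) such that every word $W$ of length at most $n$ over the alphabet $S\sqcup(H\setminus\{1\})$ (letters of $S$ may occur with exponent $\pm1$; each non-trivial element of $H$ counts as a single letter) representing $1$ in $G$ can be written in $F$ as $\prod_{i=1}^jf_i^{-1}R_if_i$ with $f_i\in F$, $R_i\in R\cup R^{-1}$, $j\le\Delta_{G,H}(n)$. "$\Delta_{G,H}$ is well-defined" means that $G$ is finitely presented relative to $H$ and $\Delta_{G,H}$ takes only finite values with respect to a finite relative presentation (this does not depend on the choice of finite relative presentation). For $G=BS(k,l)$ one has the finite relative presentation $G=\langle a,\langle t\rangle\mid\mathcal{R}\rangle$, where $\mathcal{R}$ consists of all cyclic permutations of $ta^kt^{-1}a^{-l}$ and its inverse. *)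

theory Defs
  imports "HOL-Algebra.Generated_Groups" "HOL-Library.Extended_Nat"
begin

section \<open>Groups of words modulo rewriting\<close>

inductive word_eq :: "('x list \<times> 'x list) set \<Rightarrow> 'x list \<Rightarrow> 'x list \<Rightarrow> bool"
  for rel :: "('x list \<times> 'x list) set" where
  rewrite: "(u, v) \<in> rel \<Longrightarrow> word_eq rel (p @ u @ q) (p @ v @ q)"
| refl: "word_eq rel w w"
| sym: "word_eq rel v w \<Longrightarrow> word_eq rel w v"
| trans: "word_eq rel u v \<Longrightarrow> word_eq rel v w \<Longrightarrow> word_eq rel u w"

definition word_class :: "('x list \<times> 'x list) set \<Rightarrow> 'x list \<Rightarrow> 'x list set" where
  "word_class rel w = {v. word_eq rel w v}"

text \<open>The monoid of words over the alphabet \<open>X\<close> modulo the congruence generated by \<open>rel\<close>,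
  which is meant to relate words over \<open>X\<close> only.\<close>

definition word_monoid :: "'x set \<Rightarrow> ('x list \<times> 'x list) set \<Rightarrow> 'x list set monoid" where
  "word_monoid X rel =
     \<lparr>carrier = word_class rel ` lists X,
      monoid.mult = (\<lambda>U V. \<Union>u\<in>U. \<Union>v\<in>V. word_class rel (u @ v)),
      one = word_class rel []\<rparr>"

definition list_mult :: "('g, 'm) monoid_scheme \<Rightarrow> 'g list \<Rightarrow> 'g" where
  "list_mult G xs = foldr (\<otimes>\<^bsub>G\<^esub>) xs \<one>\<^bsub>G\<^esub>"

text \<open>The map that a letter assignment \<open>f\<close> induces on classes of words. It is meaningful only if
  \<open>f\<close> respects the relations, so that all words of a class have the same value.\<close>

definition word_lift :: "('g, 'm) monoid_scheme \<Rightarrow> ('x \<Rightarrow> 'g) \<Rightarrow> 'x list set \<Rightarrow> 'g" where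
  "word_lift G f U = the_elem ((\<lambda>w. list_mult G (map f w)) ` U)"

section \<open>Free groups and free products\<close>

text \<open>The letter \<open>(x, True)\<close> stands for the generator \<open>x\<close>, and \<open>(x, False)\<close> for its inverse.\<close>

definition free_group_rel :: "'x set \<Rightarrow> (('x \<times> bool) list \<times> ('x \<times> bool) list) set" where
  "free_group_rel X = {([(x, b), (x, \<not> b)], []) | x b. x \<in> X}"

definition free_group :: "'x set \<Rightarrow> ('x \<times> bool) list set monoid" where
  "free_group X = word_monoid (X \<times> UNIV) (free_group_rel X)"

definition free_gen :: "'x set \<Rightarrow> 'x \<Rightarrow> ('x \<times> bool) list set" where
  "free_gen X x = word_class (free_group_rel X) [(x, True)]"

definition signed :: "('g, 'm) monoid_scheme \<Rightarrow> ('x \<Rightarrow> 'g) \<Rightarrow> 'x \<times> bool \<Rightarrow> 'g" where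
  "signed G f = (\<lambda>(x, b). if b then f x else inv\<^bsub>G\<^esub> (f x))"

definition free_group_lift ::
    "('g, 'm) monoid_scheme \<Rightarrow> ('x \<Rightarrow> 'g) \<Rightarrow> ('x \<times> bool) list set \<Rightarrow> 'g" where
  "free_group_lift G f = word_lift G (signed G f)"

definition free_product_rel ::
    "('a, 'm) monoid_scheme \<Rightarrow> ('b, 'n) monoid_scheme \<Rightarrow> (('a + 'b) list \<times> ('a + 'b) list) set" where
  "free_product_rel A B =
     {([Inl x, Inl y], [Inl (x \<otimes>\<^bsub>A\<^esub> y)]) | x y. x \<in> carrier A \<and> y \<in> carrier A} \<union>
     {([Inr x, Inr y], [Inr (x \<otimes>\<^bsub>B\<^esub> y)]) | x y. x \<in> carrier B \<and> y \<in> carrier B} \<union>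
     {([Inl \<one>\<^bsub>A\<^esub>], []), ([Inr \<one>\<^bsub>B\<^esub>], [])}"

definition free_product ::
    "('a, 'm) monoid_scheme \<Rightarrow> ('b, 'n) monoid_scheme \<Rightarrow> ('a + 'b) list set monoid" where
  "free_product A B = word_monoid (carrier A <+> carrier B) (free_product_rel A B)"

definition free_product_inl ::
    "('a, 'm) monoid_scheme \<Rightarrow> ('b, 'n) monoid_scheme \<Rightarrow> 'a \<Rightarrow> ('a + 'b) list set" where
  "free_product_inl A B x = word_class (free_product_rel A B) [Inl x]"

definition free_product_inr ::
    "('a, 'm) monoid_scheme \<Rightarrow> ('b, 'n) monoid_scheme \<Rightarrow> 'b \<Rightarrow> ('a + 'b) list set" where
  "free_product_inr A B y = word_class (free_product_rel A B) [Inr y]"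

definition free_product_lift ::
    "('g, 'm) monoid_scheme \<Rightarrow> ('a \<Rightarrow> 'g) \<Rightarrow> ('b \<Rightarrow> 'g) \<Rightarrow> ('a + 'b) list set \<Rightarrow> 'g" where
  "free_product_lift G f g = word_lift G (case_sum f g)"

definition normal_closure :: "('g, 'm) monoid_scheme \<Rightarrow> 'g set \<Rightarrow> 'g set" where
  "normal_closure G R = \<Inter>{N. N \<lhd> G \<and> R \<subseteq> N}"

section \<open>Relative presentations\<close>

text \<open>The free product \<open>F(S) * H\<close>, for a subset \<open>S\<close> and a subgroup \<open>H\<close> of \<open>G\<close>.
  Being a free product, it keeps an element of \<open>S \<inter> H\<close> as a free generator apart from
  the same element taken in \<open>H\<close>.\<close>

definition rel_free ::
    "('g, 'm) monoid_scheme \<Rightarrow> 'g set \<Rightarrow> 'g set \<Rightarrow> (('g \<times> bool) list set + 'g) list set monoid" where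
  "rel_free G H S = free_product (free_group S) (G\<lparr>carrier := H\<rparr>)"

definition rel_hom ::
    "('g, 'm) monoid_scheme \<Rightarrow> (('g \<times> bool) list set + 'g) list set \<Rightarrow> 'g" where
  "rel_hom G = free_product_lift G (free_group_lift G id) id"

definition generated_rel :: "('g, 'm) monoid_scheme \<Rightarrow> 'g set \<Rightarrow> 'g set \<Rightarrow> bool" where
  "generated_rel G H S \<longleftrightarrow> S \<subseteq> carrier G \<and> rel_hom G ` carrier (rel_free G H S) = carrier G"

definition rel_presentation ::
    "('g, 'm) monoid_scheme \<Rightarrow> 'g set \<Rightarrow> 'g set \<Rightarrow>
     (('g \<times> bool) list set + 'g) list set set \<Rightarrow> bool" where
  "rel_presentation G H S R \<longleftrightarrow>
     generated_rel G H S \<and> R \<subseteq> carrier (rel_free G H S) \<and>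
     normal_closure (rel_free G H S) R = kernel (rel_free G H S) G (rel_hom G)"

definition finite_rel_presentation ::
    "('g, 'm) monoid_scheme \<Rightarrow> 'g set \<Rightarrow> 'g set \<Rightarrow>
     (('g \<times> bool) list set + 'g) list set set \<Rightarrow> bool" where
  "finite_rel_presentation G H S R \<longleftrightarrow> rel_presentation G H S R \<and> finite S \<and> finite R"

section \<open>The relative Dehn function\<close>

definition rel_alphabet ::
    "('g, 'm) monoid_scheme \<Rightarrow> 'g set \<Rightarrow> 'g set \<Rightarrow> ('g \<times> bool + 'g) set" where
  "rel_alphabet G H S = (S \<times> UNIV) <+> (H - {\<one>\<^bsub>G\<^esub>})"

definition rel_letter ::
    "('g, 'm) monoid_scheme \<Rightarrow> 'g set \<Rightarrow> 'g set \<Rightarrow> 'g \<times> bool + 'g \<Rightarrow>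
     (('g \<times> bool) list set + 'g) list set" where
  "rel_letter G H S =
     case_sum
       (signed (rel_free G H S)
          (\<lambda>s. free_product_inl (free_group S) (G\<lparr>carrier := H\<rparr>) (free_gen S s)))
       (free_product_inr (free_group S) (G\<lparr>carrier := H\<rparr>))"

definition rel_word_value ::
    "('g, 'm) monoid_scheme \<Rightarrow> 'g set \<Rightarrow> 'g set \<Rightarrow> ('g \<times> bool + 'g) list \<Rightarrow>
     (('g \<times> bool) list set + 'g) list set" where
  "rel_word_value G H S W = list_mult (rel_free G H S) (map (rel_letter G H S) W)"

definition conj_product :: "('f, 'm) monoid_scheme \<Rightarrow> 'f set \<Rightarrow> nat \<Rightarrow> 'f \<Rightarrow> bool" where
  "conj_product F R j w \<longleftrightarrow>
     (\<exists>f r. (\<forall>i<j. f i \<in> carrier F \<and> r i \<in> R \<union> m_inv F ` R) \<and>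
        w = list_mult F (map (\<lambda>i. inv\<^bsub>F\<^esub> (f i) \<otimes>\<^bsub>F\<^esub> r i \<otimes>\<^bsub>F\<^esub> f i) [0..<j]))"

definition rel_dehn ::
    "('g, 'm) monoid_scheme \<Rightarrow> 'g set \<Rightarrow> 'g set \<Rightarrow>
     (('g \<times> bool) list set + 'g) list set set \<Rightarrow> nat \<Rightarrow> enat" where
  "rel_dehn G H S R n =
     (LEAST d::enat. \<forall>W \<in> lists (rel_alphabet G H S).
        length W \<le> n \<and> rel_hom G (rel_word_value G H S W) = \<one>\<^bsub>G\<^esub> \<longrightarrow>
        (\<exists>j. enat j \<le> d \<and> conj_product (rel_free G H S) R j (rel_word_value G H S W)))"

definition rel_dehn_well_defined :: "('g, 'm) monoid_scheme \<Rightarrow> 'g set \<Rightarrow> bool" where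
  "rel_dehn_well_defined G H \<longleftrightarrow>
     (\<exists>S R. finite_rel_presentation G H S R \<and> (\<forall>n. rel_dehn G H S R n \<noteq> \<infinity>))"

section \<open>Baumslag--Solitar groups\<close>

datatype bs_gen = Gen_a | Gen_t

abbreviation bs_free :: "(bs_gen \<times> bool) list set monoid" where
  "bs_free \<equiv> free_group UNIV"

definition bs_relator :: "int \<Rightarrow> int \<Rightarrow> (bs_gen \<times> bool) list set" where
  "bs_relator k l =
     (let a = free_gen UNIV Gen_a; t = free_gen UNIV Gen_t in
      t \<otimes>\<^bsub>bs_free\<^esub> a [^]\<^bsub>bs_free\<^esub> k \<otimes>\<^bsub>bs_free\<^esub> inv\<^bsub>bs_free\<^esub> t \<otimes>\<^bsub>bs_free\<^esub> inv\<^bsub>bs_free\<^esub> (a [^]\<^bsub>bs_free\<^esub> l))"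

definition BS :: "int \<Rightarrow> int \<Rightarrow> (bs_gen \<times> bool) list set set monoid" where
  "BS k l = bs_free Mod normal_closure bs_free {bs_relator k l}"

definition BS_t :: "int \<Rightarrow> int \<Rightarrow> (bs_gen \<times> bool) list set set" where
  "BS_t k l = normal_closure bs_free {bs_relator k l} #>\<^bsub>bs_free\<^esub> free_gen UNIV Gen_t"

end

theory Submission
  imports Defs Complex_Main "HOL-Computational_Algebra.Euclidean_Algorithm"
begin

text \<open>If \<open>k\<close> divides \<open>l\<close> or vice versa, then for \<open>d = k\<close> or \<open>d = l\<close> the words
  \<open>[t\<^sup>m a\<^sup>d t\<^sup>-\<^sup>m, a\<^sup>d]\<close>, whose length does not depend on \<open>m\<close>, represent 1. To see that their
  area is unbounded for every finite relative presentation, let the free group on \<open>a\<close> and \<open>t\<close>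
  act on copies of the plane over the rationals indexed by the integers: \<open>t\<close> shifts the copies
  and \<open>a\<close> shears copy \<open>i\<close> by the amount \<open>(k/l)\<^sup>i\<close>, along the first axis for \<open>i < 0\<close> and along
  the second one for \<open>i \<ge> 0\<close>. The relator of the group moves only copy 0, so the relators of any
  finite presentation, lifted to this action, move finitely many copies. The number of moved
  copies is subadditive and invariant under conjugation, but the commutator moves about \<open>m\<close> of
  them, because shears along different axes do not commute.

  If neither divides the other, then by Britton's lemma any non-trivial word that represents 1
  has a subword \<open>t a\<^sup>\<alpha> t\<^sup>-\<^sup>1\<close> or \<open>t\<^sup>-\<^sup>1 a\<^sup>\<alpha> t\<close> which can be pinched, at a cost bounded in terms of
  \<open>\<alpha>\<close>. As \<open>k / gcd k l\<close> and \<open>l / gcd k l\<close> are coprime non-units, each pinch at a site uses up a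
  factor of the exponent \<open>\<alpha>\<close> there, so the number of pinches is bounded in terms of the exponents
  of \<open>a\<close> and the number of syllables, however large the exponents of \<open>t\<close> are.\<close>

section \<open>Words modulo rewriting\<close>

lemma word_eq_append:
  assumes "word_eq rel u v"
  shows "word_eq rel (p @ u @ q) (p @ v @ q)"
  using assms
proof induction
  case (rewrite u v p' q')
  then show ?case using word_eq.rewrite[of u v rel "p @ p'" "q' @ q"] by simp
qed (auto intro: word_eq.intros)

lemma word_eq_append2:
  assumes "word_eq rel u u'" "word_eq rel v v'"
  shows "word_eq rel (u @ v) (u' @ v')"
  using word_eq_append[OF assms(1), of "[]" v] word_eq_append[OF assms(2), of u' "[]"]
  by (auto intro: word_eq.trans)

lemma word_class_eq_iff: "word_class rel u = word_class rel v \<longleftrightarrow> word_eq rel u v"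
  unfolding word_class_def by (auto intro: word_eq.intros)

lemma word_class_eqI: "(u, v) \<in> rel \<Longrightarrow> word_class rel u = word_class rel v"
  using word_eq.rewrite[of u v rel "[]" "[]"] by (simp add: word_class_eq_iff)

lemma word_monoid_mult:
  "word_class rel u \<otimes>\<^bsub>word_monoid X rel\<^esub> word_class rel v = word_class rel (u @ v)"
proof -
  have "word_class rel (u' @ v') = word_class rel (u @ v)"
    if "u' \<in> word_class rel u" "v' \<in> word_class rel v" for u' v'
  proof -
    have "word_eq rel (u @ v) (u' @ v')"
      using word_eq_append2 that unfolding word_class_def mem_Collect_eq .
    then show ?thesis unfolding word_class_eq_iff by (rule word_eq.sym)
  qed
  moreover have "word_class rel w \<noteq> {}" for w
    using word_eq.refl[of rel w] unfolding word_class_def by blast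
  ultimately show ?thesis by (simp add: word_monoid_def)
qed

lemma word_monoid_one: "\<one>\<^bsub>word_monoid X rel\<^esub> = word_class rel []"
  by (simp add: word_monoid_def)

lemma word_monoid_carrier: "carrier (word_monoid X rel) = word_class rel ` lists X"
  by (simp add: word_monoid_def)

lemma monoid_word_monoid: "monoid (word_monoid X rel)"
  by (rule monoidI) (auto simp: word_monoid_carrier word_monoid_one word_monoid_mult intro!: imageI)

text \<open>Left inverses of single letters suffice: for \<open>x # w\<close> one concatenates a
  left inverse of \<open>w\<close> with one of \<open>x\<close>, in this order.\<close>

lemma group_word_monoid:
  assumes "\<And>x. x \<in> X \<Longrightarrow> \<exists>y\<in>lists X. word_eq rel (y @ [x]) []"
  shows "group (word_monoid X rel)"
proof -
  interpret monoid "word_monoid X rel" by (rule monoid_word_monoid)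
  have inv: "\<exists>v\<in>lists X. word_eq rel (v @ w) []" if "w \<in> lists X" for w
    using that
  proof (induction w)
    case Nil
    then show ?case by (intro bexI[of _ "[]"]) (auto intro: word_eq.refl)
  next
    case (Cons x w)
    then obtain y v where yv: "y \<in> lists X" "word_eq rel (y @ [x]) []"
      "v \<in> lists X" "word_eq rel (v @ w) []"
      using assms[of x] by (auto simp del: append_in_lists_conv)
    have "word_eq rel (v @ (y @ [x]) @ w) (v @ [] @ w)"
      using yv(2) by (rule word_eq_append)
    then have "word_eq rel ((v @ y) @ x # w) []"
      using yv(4) by (auto intro: word_eq.trans)
    then show ?case using yv by (intro bexI[of _ "v @ y"]) auto
  qed
  show ?thesis
  proof (rule group_l_invI)
    fix g assume "g \<in> carrier (word_monoid X rel)"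
    then obtain w where "w \<in> lists X" "g = word_class rel w"
      by (auto simp: word_monoid_carrier)
    then show "\<exists>h\<in>carrier (word_monoid X rel). h \<otimes>\<^bsub>word_monoid X rel\<^esub> g = \<one>\<^bsub>word_monoid X rel\<^esub>"
      using inv[of w]
      by (auto simp: word_monoid_carrier word_monoid_one word_monoid_mult word_class_eq_iff)
  qed
qed

lemma list_mult_Nil [simp]: "list_mult G [] = \<one>\<^bsub>G\<^esub>"
  and list_mult_Cons [simp]: "list_mult G (x # xs) = x \<otimes>\<^bsub>G\<^esub> list_mult G xs"
  by (simp_all add: list_mult_def)

context monoid
begin

lemma list_mult_closed [intro, simp]: "set xs \<subseteq> carrier G \<Longrightarrow> list_mult G xs \<in> carrier G"
  by (induction xs) auto

lemma list_mult_append: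
  "set xs \<subseteq> carrier G \<Longrightarrow> set ys \<subseteq> carrier G \<Longrightarrow>
   list_mult G (xs @ ys) = list_mult G xs \<otimes> list_mult G ys"
  by (induction xs) (auto simp: m_assoc)

end

text \<open>The relations are required to relate words over \<open>X\<close> only, since a class
  contains every list that is reachable by rewriting and \<open>f\<close> is controlled on
  \<open>X\<close> alone.\<close>

definition respects_rel ::
    "('g, 'm) monoid_scheme \<Rightarrow> ('x \<Rightarrow> 'g) \<Rightarrow> 'x set \<Rightarrow> ('x list \<times> 'x list) set \<Rightarrow> bool" where
  "respects_rel G f X rel \<longleftrightarrow> f \<in> X \<rightarrow> carrier G \<and>
     (\<forall>(u, v)\<in>rel. u \<in> lists X \<and> v \<in> lists X \<and> list_mult G (map f u) = list_mult G (map f v))"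

text \<open>Membership and value are treated together: at a transitivity step the values can be
  compared only once the middle word is known to lie over \<open>X\<close>.\<close>

lemma (in monoid) respects_rel_word_eq:
  assumes "respects_rel G f X rel" "word_eq rel u v"
  shows "(u \<in> lists X \<longleftrightarrow> v \<in> lists X) \<and>
    (u \<in> lists X \<longrightarrow> list_mult G (map f u) = list_mult G (map f v))"
  using assms(2)
proof induction
  case (rewrite u v p q)
  have f: "set (map f w) \<subseteq> carrier G" if "w \<in> lists X" for w
    using assms(1) that unfolding respects_rel_def by auto
  have "u \<in> lists X" "v \<in> lists X" "list_mult G (map f u) = list_mult G (map f v)"
    using assms(1) rewrite unfolding respects_rel_def by auto
  then show ?case
    using f by (auto simp: list_mult_append simp del: set_map)
qed auto

lemma (in monoid) word_lift_class:
  assumes "respects_rel G f X rel" "w \<in> lists X"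
  shows "word_lift G f (word_class rel w) = list_mult G (map f w)"
proof -
  have "(\<lambda>w. list_mult G (map f w)) ` word_class rel w = {list_mult G (map f w)}"
  proof -
    have "list_mult G (map f v) = list_mult G (map f w)" if "v \<in> word_class rel w" for v
      using respects_rel_word_eq[OF assms(1), of w v] assms(2) that
      by (simp add: word_class_def del: in_lists_conv_set)
    moreover have "w \<in> word_class rel w" by (simp add: word_class_def word_eq.refl)
    ultimately show ?thesis by blast
  qed
  then show ?thesis unfolding word_lift_def by simp
qed

lemma (in monoid) word_lift_hom:
  assumes "respects_rel G f X rel"
  shows "word_lift G f \<in> hom (word_monoid X rel) G"
proof (rule homI)
  have f: "set (map f w) \<subseteq> carrier G" if "w \<in> lists X" for w
    using assms that unfolding respects_rel_def by auto
  fix g assume g: "g \<in> carrier (word_monoid X rel)"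
  then obtain u where u: "u \<in> lists X" "g = word_class rel u"
    by (auto simp: word_monoid_carrier)
  then show "word_lift G f g \<in> carrier G"
    using f[of u] by (simp add: word_lift_class[OF assms])
  fix h assume h: "h \<in> carrier (word_monoid X rel)"
  then obtain v where v: "v \<in> lists X" "h = word_class rel v"
    by (auto simp: word_monoid_carrier)
  then show "word_lift G f (g \<otimes>\<^bsub>word_monoid X rel\<^esub> h) = word_lift G f g \<otimes> word_lift G f h"
    using u f[of u] f[of v]
    by (simp add: word_monoid_mult word_lift_class[OF assms] list_mult_append del: set_map)
qed

lemma word_monoid_induct [consumes 1, case_names one mult]:
  assumes "g \<in> carrier (word_monoid X rel)"
    and "Q \<one>\<^bsub>word_monoid X rel\<^esub>"
    and "\<And>x g. x \<in> X \<Longrightarrow> g \<in> carrier (word_monoid X rel) \<Longrightarrow> Q g \<Longrightarrow>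
          Q (word_class rel [x] \<otimes>\<^bsub>word_monoid X rel\<^esub> g)"
  shows "Q g"
proof -
  have "Q (word_class rel w)" if "w \<in> lists X" for w
    using that
  proof (induction w)
    case Nil
    then show ?case using assms(2) by (simp add: word_monoid_one)
  next
    case (Cons x w)
    then show ?case using assms(3)[of x "word_class rel w"]
      by (auto simp: word_monoid_mult word_monoid_carrier)
  qed
  then show ?thesis using assms(1) by (auto simp: word_monoid_carrier)
qed

section \<open>Free groups\<close>

lemma group_free_group: "group (free_group X)"
  unfolding free_group_def
proof (rule group_word_monoid, clarify)
  fix x :: 'a and b :: bool assume "x \<in> X"
  then have "([(x, \<not> b), (x, \<not> \<not> b)], []) \<in> free_group_rel X"
    unfolding free_group_rel_def by blast
  then have "word_eq (free_group_rel X) ([(x, \<not> b)] @ [(x, b)]) []"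
    by (simp flip: word_class_eq_iff add: word_class_eqI)
  then show "\<exists>y\<in>lists (X \<times> UNIV). word_eq (free_group_rel X) (y @ [(x, b)]) []"
    using \<open>x \<in> X\<close> by (intro bexI[of _ "[(x, \<not> b)]"]) auto
qed

lemma free_gen_closed [simp]: "x \<in> X \<Longrightarrow> free_gen X x \<in> carrier (free_group X)"
  unfolding free_gen_def free_group_def word_monoid_carrier by auto

lemma inv_free_gen:
  assumes "x \<in> X"
  shows "inv\<^bsub>free_group X\<^esub> (free_gen X x) = word_class (free_group_rel X) [(x, False)]"
proof -
  interpret group "free_group X" by (rule group_free_group)
  have "([(x, False), (x, \<not> False)], []) \<in> free_group_rel X"
    using assms unfolding free_group_rel_def by blast
  then have "word_class (free_group_rel X) [(x, False)] \<otimes>\<^bsub>free_group X\<^esub> free_gen X x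
      = \<one>\<^bsub>free_group X\<^esub>"
    unfolding free_gen_def free_group_def word_monoid_mult word_monoid_one
    by (simp add: word_class_eqI)
  moreover have "word_class (free_group_rel X) [(x, False)] \<in> carrier (free_group X)"
    using assms unfolding free_group_def word_monoid_carrier by auto
  ultimately show ?thesis using assms by (simp add: inv_equality)
qed

lemma free_group_letter:
  assumes "x \<in> X"
  shows "word_class (free_group_rel X) [(x, b)] = signed (free_group X) (free_gen X) (x, b)"
  using assms by (simp add: signed_def inv_free_gen) (simp add: free_gen_def)

lemma free_group_lift:
  assumes "group G" "f \<in> X \<rightarrow> carrier G"
  shows free_group_lift_hom: "free_group_lift G f \<in> hom (free_group X) G"
    and free_group_lift_gen: "x \<in> X \<Longrightarrow> free_group_lift G f (free_gen X x) = f x"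
proof -
  interpret group G by fact
  have "respects_rel G (signed G f) (X \<times> UNIV) (free_group_rel X)"
    using assms(2)
    by (auto simp: respects_rel_def free_group_rel_def signed_def dest: funcset_mem)
  note r = word_lift_hom[OF this] word_lift_class[OF this]
  show "free_group_lift G f \<in> hom (free_group X) G"
    using r(1) by (simp add: free_group_lift_def free_group_def)
  show "free_group_lift G f (free_gen X x) = f x" if "x \<in> X"
    using r(2)[of "[(x, True)]"] that funcset_mem[OF assms(2) that]
    by (auto simp: free_group_lift_def free_gen_def signed_def)
qed

lemma free_group_subgroup_eq:
  assumes "subgroup K (free_group X)" "free_gen X ` X \<subseteq> K"
  shows "K = carrier (free_group X)"
proof -
  interpret group "free_group X" by (rule group_free_group)
  have letter: "word_class (free_group_rel X) [x] \<in> K" if "x \<in> X \<times> UNIV" for x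
    using that assms by (cases x) (auto simp: free_group_letter signed_def subgroup.m_inv_closed)
  have "g \<in> K" if "g \<in> carrier (free_group X)" for g
    using that unfolding free_group_def
  proof (induction rule: word_monoid_induct)
    case one
    then show ?case using subgroup.one_closed[OF assms(1)] by (simp add: free_group_def)
  next
    case (mult x g)
    then show ?case using subgroup.m_closed[OF assms(1) letter[of x] mult(3)]
      by (simp add: free_group_def)
  qed
  then show ?thesis using subgroup.subset[OF assms(1)] by auto
qed

text \<open>Applied to an equalizer that contains the generators, this yields uniqueness of
  homomorphisms out of free groups and relative free groups.\<close>

lemma hom_equalizer_subgroup:
  assumes "group G" "group K" "f \<in> hom G K" "g \<in> hom G K"
  shows "subgroup {x \<in> carrier G. f x = g x} G"
proof -
  interpret f: group_hom G K f using assms by (simp add: group_hom_def group_hom_axioms_def)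
  interpret g: group_hom G K g using assms by (simp add: group_hom_def group_hom_axioms_def)
  show ?thesis by (rule group.subgroupI[OF assms(1)]) auto
qed

lemma free_group_hom_eqI:
  assumes "group K" "f \<in> hom (free_group X) K" "g \<in> hom (free_group X) K"
    and "\<And>x. x \<in> X \<Longrightarrow> f (free_gen X x) = g (free_gen X x)"
    and "w \<in> carrier (free_group X)"
  shows "f w = g w"
proof -
  have "{x \<in> carrier (free_group X). f x = g x} = carrier (free_group X)"
    using assms(4)
    by (intro free_group_subgroup_eq hom_equalizer_subgroup[OF group_free_group assms(1-3)]) auto
  then show ?thesis using assms(5) by blast
qed

section \<open>Free products\<close>

lemma group_free_product:
  assumes "group A" "group B"
  shows "group (free_product A B)"
  unfolding free_product_def
proof (rule group_word_monoid)
  interpret A: group A by fact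
  interpret B: group B by fact
  let ?R = "free_product_rel A B"
  fix z assume z: "z \<in> carrier A <+> carrier B"
  then show "\<exists>y\<in>lists (carrier A <+> carrier B). word_eq ?R (y @ [z]) []"
  proof (cases z)
    case (Inl x)
    with z have x: "x \<in> carrier A" by auto
    have "([Inl (inv\<^bsub>A\<^esub> x), Inl x], [Inl (inv\<^bsub>A\<^esub> x \<otimes>\<^bsub>A\<^esub> x)]) \<in> ?R"
      using x unfolding free_product_rel_def by blast
    moreover have "([Inl \<one>\<^bsub>A\<^esub>], []) \<in> ?R" unfolding free_product_rel_def by blast
    ultimately have "word_eq ?R ([Inl (inv\<^bsub>A\<^esub> x)] @ [z]) []"
      using x Inl by (simp flip: word_class_eq_iff add: word_class_eqI)
    then show ?thesis using x by (intro bexI[of _ "[Inl (inv\<^bsub>A\<^esub> x)]"]) auto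
  next
    case (Inr x)
    with z have x: "x \<in> carrier B" by auto
    have "([Inr (inv\<^bsub>B\<^esub> x), Inr x], [Inr (inv\<^bsub>B\<^esub> x \<otimes>\<^bsub>B\<^esub> x)]) \<in> ?R"
      using x unfolding free_product_rel_def by blast
    moreover have "([Inr \<one>\<^bsub>B\<^esub>], []) \<in> ?R" unfolding free_product_rel_def by blast
    ultimately have "word_eq ?R ([Inr (inv\<^bsub>B\<^esub> x)] @ [z]) []"
      using x Inr by (simp flip: word_class_eq_iff add: word_class_eqI)
    then show ?thesis using x by (intro bexI[of _ "[Inr (inv\<^bsub>B\<^esub> x)]"]) auto
  qed
qed

lemma free_product_inl_hom: "free_product_inl A B \<in> hom A (free_product A B)"
proof (rule homI)
  fix x y assume "x \<in> carrier A" "y \<in> carrier A"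
  then have "([Inl x, Inl y], [Inl (x \<otimes>\<^bsub>A\<^esub> y)]) \<in> free_product_rel A B"
    unfolding free_product_rel_def by blast
  then show "free_product_inl A B (x \<otimes>\<^bsub>A\<^esub> y) =
      free_product_inl A B x \<otimes>\<^bsub>free_product A B\<^esub> free_product_inl A B y"
    by (simp add: free_product_inl_def free_product_def word_monoid_mult word_class_eqI)
qed (auto simp: free_product_inl_def free_product_def word_monoid_carrier)

lemma free_product_inr_hom: "free_product_inr A B \<in> hom B (free_product A B)"
proof (rule homI)
  fix x y assume "x \<in> carrier B" "y \<in> carrier B"
  then have "([Inr x, Inr y], [Inr (x \<otimes>\<^bsub>B\<^esub> y)]) \<in> free_product_rel A B"
    unfolding free_product_rel_def by blast
  then show "free_product_inr A B (x \<otimes>\<^bsub>B\<^esub> y) =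
      free_product_inr A B x \<otimes>\<^bsub>free_product A B\<^esub> free_product_inr A B y"
    by (simp add: free_product_inr_def free_product_def word_monoid_mult word_class_eqI)
qed (auto simp: free_product_inr_def free_product_def word_monoid_carrier)

lemma free_product_lift:
  assumes "group A" "group B" "group G" "f \<in> hom A G" "g \<in> hom B G"
  shows free_product_lift_hom: "free_product_lift G f g \<in> hom (free_product A B) G"
    and free_product_lift_inl:
      "x \<in> carrier A \<Longrightarrow> free_product_lift G f g (free_product_inl A B x) = f x"
    and free_product_lift_inr:
      "y \<in> carrier B \<Longrightarrow> free_product_lift G f g (free_product_inr A B y) = g y"
proof -
  interpret f: group_hom A G f using assms by (simp add: group_hom_def group_hom_axioms_def)
  interpret g: group_hom B G g using assms by (simp add: group_hom_def group_hom_axioms_def)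
  have "respects_rel G (case_sum f g) (carrier A <+> carrier B) (free_product_rel A B)"
    by (auto simp: respects_rel_def free_product_rel_def)
  note r = f.H.word_lift_hom[OF this] f.H.word_lift_class[OF this]
  show "free_product_lift G f g \<in> hom (free_product A B) G"
    using r(1) by (simp add: free_product_lift_def free_product_def)
  show "free_product_lift G f g (free_product_inl A B x) = f x" if "x \<in> carrier A"
    using r(2)[of "[Inl x]"] that by (auto simp: free_product_lift_def free_product_inl_def)
  show "free_product_lift G f g (free_product_inr A B y) = g y" if "y \<in> carrier B"
    using r(2)[of "[Inr y]"] that by (auto simp: free_product_lift_def free_product_inr_def)
qed

lemma free_product_subgroup_eq:
  assumes "subgroup K (free_product A B)"
    and "free_product_inl A B ` carrier A \<subseteq> K" "free_product_inr A B ` carrier B \<subseteq> K"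
  shows "K = carrier (free_product A B)"
proof -
  have letter: "word_class (free_product_rel A B) [z] \<in> K" if "z \<in> carrier A <+> carrier B" for z
    using that assms(2,3) by (auto simp: free_product_inl_def free_product_inr_def)
  have "g \<in> K" if "g \<in> carrier (free_product A B)" for g
    using that unfolding free_product_def
  proof (induction rule: word_monoid_induct)
    case one
    then show ?case using subgroup.one_closed[OF assms(1)] by (simp add: free_product_def)
  next
    case (mult x g)
    then show ?case using subgroup.m_closed[OF assms(1) letter[of x] mult(3)]
      by (simp add: free_product_def)
  qed
  then show ?thesis using subgroup.subset[OF assms(1)] by auto
qed

section \<open>Relative free groups\<close>

locale relative_group = group G for G (structure) +
  fixes H S :: "'a set"
  assumes subgroup_H: "subgroup H G" and S_closed: "S \<subseteq> carrier G"
begin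

abbreviation "P \<equiv> rel_free G H S"
abbreviation "gen s \<equiv> free_product_inl (free_group S) (G\<lparr>carrier := H\<rparr>) (free_gen S s)"
abbreviation "inc \<equiv> free_product_inr (free_group S) (G\<lparr>carrier := H\<rparr>)"

lemma group_H: "group (G\<lparr>carrier := H\<rparr>)"
  by (rule subgroup.subgroup_is_group[OF subgroup_H is_group])

sublocale P: group P
  unfolding rel_free_def by (rule group_free_product[OF group_free_group group_H])

lemma inl_hom: "free_product_inl (free_group S) (G\<lparr>carrier := H\<rparr>) \<in> hom (free_group S) P"
  unfolding rel_free_def by (rule free_product_inl_hom)

lemma gen_closed [simp]: "s \<in> S \<Longrightarrow> gen s \<in> carrier P"
  using hom_in_carrier[OF inl_hom] by simp

lemma inc_hom: "inc \<in> hom (G\<lparr>carrier := H\<rparr>) P"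
  unfolding rel_free_def by (rule free_product_inr_hom)

lemma inc_closed [simp]: "h \<in> H \<Longrightarrow> inc h \<in> carrier P"
  using hom_in_carrier[OF inc_hom] by simp

lemma inc_mult: "g \<in> H \<Longrightarrow> h \<in> H \<Longrightarrow> inc (g \<otimes> h) = inc g \<otimes>\<^bsub>P\<^esub> inc h"
  using hom_mult[OF inc_hom] by simp

lemma rel_free_lift:
  assumes "group K" "f \<in> S \<rightarrow> carrier K" "\<eta> \<in> hom (G\<lparr>carrier := H\<rparr>) K"
  defines "\<Phi> \<equiv> free_product_lift K (free_group_lift K f) \<eta>"
  shows rel_free_lift_hom: "\<Phi> \<in> hom P K"
    and rel_free_lift_gen: "s \<in> S \<Longrightarrow> \<Phi> (gen s) = f s"
    and rel_free_lift_inc: "h \<in> H \<Longrightarrow> \<Phi> (inc h) = \<eta> h"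
proof -
  note l = free_product_lift[OF group_free_group group_H assms(1)
      free_group_lift_hom[OF assms(1,2)] assms(3)]
  show "\<Phi> \<in> hom P K" using l(1) by (simp add: \<Phi>_def rel_free_def)
  show "s \<in> S \<Longrightarrow> \<Phi> (gen s) = f s"
    using l(2) free_group_lift_gen[OF assms(1,2)] by (simp add: \<Phi>_def)
  show "h \<in> H \<Longrightarrow> \<Phi> (inc h) = \<eta> h"
    using l(3) by (simp add: \<Phi>_def)
qed

lemma id_lift: "id \<in> S \<rightarrow> carrier G" "id \<in> hom (G\<lparr>carrier := H\<rparr>) G"
  using S_closed subgroup.subset[OF subgroup_H] by (auto simp: hom_def)

lemma rel_hom_hom: "rel_hom G \<in> hom P G"
  and rel_hom_gen: "s \<in> S \<Longrightarrow> rel_hom G (gen s) = s"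
  and rel_hom_inc: "h \<in> H \<Longrightarrow> rel_hom G (inc h) = h"
  unfolding rel_hom_def using rel_free_lift[OF is_group id_lift] by simp_all

sublocale rel: group_hom P G "rel_hom G"
  by unfold_locales (rule rel_hom_hom)

text \<open>The preimage of \<open>K\<close> in the free factor contains the free generators, hence
  is the whole factor; then generation by the two factors applies.\<close>

lemma rel_free_subgroup_eq:
  assumes K: "subgroup K P" and "gen ` S \<subseteq> K" "inc ` H \<subseteq> K"
  shows "K = carrier P"
proof -
  interpret inl: group_hom "free_group S" P "free_product_inl (free_group S) (G\<lparr>carrier := H\<rparr>)"
    using inl_hom by (simp add: group_hom_def group_hom_axioms_def group_free_group P.is_group)
  let ?L = "{x \<in> carrier (free_group S). free_product_inl (free_group S) (G\<lparr>carrier := H\<rparr>) x \<in> K}"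
  have "subgroup ?L (free_group S)"
    by (rule group.subgroupI[OF group_free_group])
      (use subgroup.one_closed[OF K] subgroup.m_closed[OF K] subgroup.m_inv_closed[OF K] in
        \<open>auto simp: inl.hom_one intro!: exI[of _ "\<one>\<^bsub>free_group S\<^esub>"]\<close>)
  moreover have "free_gen S ` S \<subseteq> ?L" using assms(2) by auto
  ultimately have "?L = carrier (free_group S)" by (rule free_group_subgroup_eq)
  then show ?thesis unfolding rel_free_def
    using K assms(3) by (intro free_product_subgroup_eq) (auto simp: rel_free_def)
qed

lemma rel_free_hom_eqI:
  assumes "group K" "f \<in> hom P K" "g \<in> hom P K"
    and "\<And>s. s \<in> S \<Longrightarrow> f (gen s) = g (gen s)" "\<And>h. h \<in> H \<Longrightarrow> f (inc h) = g (inc h)"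
    and "w \<in> carrier P"
  shows "f w = g w"
proof -
  have "{x \<in> carrier P. f x = g x} = carrier P"
    using assms(4,5)
    by (intro rel_free_subgroup_eq hom_equalizer_subgroup[OF P.is_group assms(1-3)]) auto
  then show ?thesis using assms(6) by blast
qed

lemma rel_letter_Inl: "rel_letter G H S (Inl (s, b)) = (if b then gen s else inv\<^bsub>P\<^esub> gen s)"
  and rel_letter_Inr: "rel_letter G H S (Inr h) = inc h"
  by (simp_all add: rel_letter_def signed_def)

lemma rel_letter_closed: "x \<in> rel_alphabet G H S \<Longrightarrow> rel_letter G H S x \<in> carrier P"
  by (auto simp: rel_alphabet_def rel_letter_Inl rel_letter_Inr)

lemma set_rel_letter: "W \<in> lists (rel_alphabet G H S) \<Longrightarrow>
    set (map (rel_letter G H S) W) \<subseteq> carrier P"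
  using rel_letter_closed by auto

lemma rel_word_value_closed:
  "W \<in> lists (rel_alphabet G H S) \<Longrightarrow> rel_word_value G H S W \<in> carrier P"
  unfolding rel_word_value_def by (rule P.list_mult_closed[OF set_rel_letter])

lemma rel_word_value_append:
  "V \<in> lists (rel_alphabet G H S) \<Longrightarrow> W \<in> lists (rel_alphabet G H S) \<Longrightarrow>
   rel_word_value G H S (V @ W) = rel_word_value G H S V \<otimes>\<^bsub>P\<^esub> rel_word_value G H S W"
  unfolding rel_word_value_def map_append
  by (rule P.list_mult_append[OF set_rel_letter set_rel_letter])

lemma rel_word_value_letter:
  "x \<in> rel_alphabet G H S \<Longrightarrow> rel_word_value G H S [x] = rel_letter G H S x"
  using rel_letter_closed by (simp add: rel_word_value_def)

text \<open>The alphabet is closed under inverses, so the inverse word is spelled backwards letter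
  by letter.\<close>

lemma rel_word_value_inv:
  assumes "W \<in> lists (rel_alphabet G H S)"
  shows "\<exists>V\<in>lists (rel_alphabet G H S). rel_word_value G H S V = inv\<^bsub>P\<^esub> rel_word_value G H S W"
  using assms
proof (induction W)
  case Nil
  then show ?case by (intro bexI[of _ "[]"]) (auto simp: rel_word_value_def)
next
  case (Cons x W)
  then obtain V where V: "V \<in> lists (rel_alphabet G H S)"
    "rel_word_value G H S V = inv\<^bsub>P\<^esub> rel_word_value G H S W"
    by auto
  have x: "x \<in> rel_alphabet G H S" and W: "W \<in> lists (rel_alphabet G H S)" using Cons by auto
  obtain y where y: "y \<in> rel_alphabet G H S" "rel_letter G H S y = inv\<^bsub>P\<^esub> rel_letter G H S x"
  proof (cases x)
    case (Inl sb)
    obtain s b where sb: "sb = (s, b)" by fastforce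
    then show ?thesis using that[of "Inl (s, \<not> b)"] x Inl
      by (cases b) (auto simp: rel_alphabet_def rel_letter_Inl InlI)
  next
    case (Inr h)
    interpret inc: group_hom "G\<lparr>carrier := H\<rparr>" P inc
      using inc_hom by (simp add: group_hom_def group_hom_axioms_def group_H P.is_group)
    have h: "h \<in> H" "h \<noteq> \<one>" using x Inr by (auto simp: rel_alphabet_def)
    then have "inv h \<in> H" "inv h \<noteq> \<one>"
      using subgroup.m_inv_closed[OF subgroup_H] subgroup.mem_carrier[OF subgroup_H] inv_eq_1_iff
      by auto
    moreover have "inc (inv h) = inv\<^bsub>P\<^esub> inc h"
      using inc.hom_inv[of h] h m_inv_consistent[OF subgroup_H h(1)] by simp
    ultimately show ?thesis using that[of "Inr (inv h)"] Inr
      by (auto simp: rel_alphabet_def rel_letter_Inr)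
  qed
  have "rel_word_value G H S (V @ [y]) = inv\<^bsub>P\<^esub> (rel_letter G H S x \<otimes>\<^bsub>P\<^esub> rel_word_value G H S W)"
    using V y x W rel_letter_closed[OF x] rel_word_value_closed[OF W]
    by (subst rel_word_value_append) (auto simp: rel_word_value_letter P.inv_mult_group)
  then show ?case using V y
    by (intro bexI[of _ "V @ [y]"]) (auto simp: rel_word_value_def)
qed

text \<open>It supplies a fixed word for a power of \<open>a\<close> when the finite generating set
  is arbitrary.\<close>

lemma rel_word_value_surj:
  assumes "g \<in> carrier P"
  obtains W where "W \<in> lists (rel_alphabet G H S)" "rel_word_value G H S W = g"
proof -
  let ?A = "rel_alphabet G H S" and ?v = "rel_word_value G H S"
  have "?v ` lists ?A = carrier P"
  proof (rule rel_free_subgroup_eq)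
    show "subgroup (?v ` lists ?A) P"
    proof (rule P.subgroupI)
      show "?v ` lists ?A \<subseteq> carrier P" using rel_word_value_closed by blast
      show "?v ` lists ?A \<noteq> {}" by blast
      show "inv\<^bsub>P\<^esub> a \<in> ?v ` lists ?A" if "a \<in> ?v ` lists ?A" for a
      proof -
        from that obtain W where W: "W \<in> lists ?A" "a = ?v W" by blast
        then obtain V where "V \<in> lists ?A" "?v V = inv\<^bsub>P\<^esub> a"
          using rel_word_value_inv[OF W(1)] by blast
        then show ?thesis by (intro image_eqI[of _ _ V]) simp_all
      qed
      show "a \<otimes>\<^bsub>P\<^esub> b \<in> ?v ` lists ?A" if "a \<in> ?v ` lists ?A" "b \<in> ?v ` lists ?A" for a b
      proof -
        from that obtain V W where "V \<in> lists ?A" "a = ?v V" "W \<in> lists ?A" "b = ?v W"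
          by blast
        then show ?thesis
          by (intro image_eqI[of _ _ "V @ W"]) (auto simp: rel_word_value_append)
      qed
    qed
    have "gen s \<in> ?v ` lists ?A" if "s \<in> S" for s
      using that rel_word_value_letter[of "Inl (s, True)"]
      by (intro image_eqI[of _ _ "[Inl (s, True)]"]) (auto simp: rel_alphabet_def rel_letter_Inl)
    then show "gen ` S \<subseteq> ?v ` lists ?A" by blast
    have "inc h \<in> ?v ` lists ?A" if "h \<in> H" for h
    \<comment> \<open>The identity of \<open>H\<close> is not a letter, so it is the value of the
      empty word instead.\<close>
    proof (cases "h = \<one>")
      case True
      interpret inc: group_hom "G\<lparr>carrier := H\<rparr>" P inc
        using inc_hom by (simp add: group_hom_def group_hom_axioms_def group_H P.is_group)
      show ?thesis using inc.hom_one True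
        by (intro image_eqI[of _ _ "[]"]) (auto simp: rel_word_value_def)
    next
      case False
      then show ?thesis
        using \<open>h \<in> H\<close> rel_word_value_letter[of "Inr h"]
        by (intro image_eqI[of _ _ "[Inr h]"]) (auto simp: rel_alphabet_def rel_letter_Inr)
    qed
    then show "inc ` H \<subseteq> ?v ` lists ?A" by blast
  qed
  with assms have "g \<in> ?v ` lists ?A" by simp
  then show ?thesis by (elim imageE) (rule that, simp_all)
qed

end

section \<open>Products of conjugates of relators\<close>

context group
begin

lemma mult_inv_cancel_left [simp]:
  "x \<in> carrier G \<Longrightarrow> y \<in> carrier G \<Longrightarrow> x \<otimes> (inv x \<otimes> y) = y"
  "x \<in> carrier G \<Longrightarrow> y \<in> carrier G \<Longrightarrow> inv x \<otimes> (x \<otimes> y) = y"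
  by (simp_all flip: m_assoc)

lemma normal_closure_normal:
  assumes "R \<subseteq> carrier G"
  shows "normal_closure G R \<lhd> G"
proof -
  let ?A = "{N. N \<lhd> G \<and> R \<subseteq> N}"
  have ne: "carrier G \<in> ?A"
    using assms subgroup_self by (auto simp: normal_inv_iff)
  have sg: "subgroup (\<Inter>?A) G"
    using ne by (intro subgroups_Inter) (auto intro: normal_imp_subgroup)
  show ?thesis unfolding normal_closure_def
  proof (rule normal_invI[OF sg])
    fix x h assume "x \<in> carrier G" "h \<in> \<Inter>?A"
    then show "x \<otimes> h \<otimes> inv x \<in> \<Inter>?A" using normal_invE(2) by blast
  qed
qed

lemma normal_closure_superset: "R \<subseteq> normal_closure G R"
  unfolding normal_closure_def by blast

lemma normal_closure_minimal: "N \<lhd> G \<Longrightarrow> R \<subseteq> N \<Longrightarrow> normal_closure G R \<subseteq> N"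
  unfolding normal_closure_def by blast

lemma conj_product_0: "conj_product G R 0 w \<longleftrightarrow> w = \<one>"
  by (simp add: conj_product_def)

text \<open>A recursion for the number of factors, which replaces the choice functions of the
  definition in all later inductions.\<close>

lemma conj_product_Suc:
  assumes R: "R \<subseteq> carrier G"
  shows "conj_product G R (Suc j) w \<longleftrightarrow>
    (\<exists>w' f r. conj_product G R j w' \<and> f \<in> carrier G \<and> r \<in> R \<union> m_inv G ` R \<and>
      w = w' \<otimes> (inv f \<otimes> r \<otimes> f))" (is "?l = ?r")
proof
  have cl: "inv f \<otimes> r \<otimes> f \<in> carrier G" if "f \<in> carrier G" "r \<in> R \<union> m_inv G ` R" for f r
    using that R by auto
  {
    assume ?l
    then obtain f r where fr: "\<forall>i<Suc j. f i \<in> carrier G \<and> r i \<in> R \<union> m_inv G ` R"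
      "w = list_mult G (map (\<lambda>i. inv (f i) \<otimes> r i \<otimes> f i) [0..<Suc j])"
      unfolding conj_product_def by blast
    have "w = list_mult G (map (\<lambda>i. inv (f i) \<otimes> r i \<otimes> f i) [0..<j]) \<otimes> (inv (f j) \<otimes> r j \<otimes> f j)"
      using cl fr(1) unfolding fr(2) upt_Suc_append[OF le0] map_append
      by (subst list_mult_append) (auto simp: less_Suc_eq)
    moreover have "conj_product G R j (list_mult G (map (\<lambda>i. inv (f i) \<otimes> r i \<otimes> f i) [0..<j]))"
      using fr(1) unfolding conj_product_def by (intro exI[of _ f] exI[of _ r]) auto
    moreover have "f j \<in> carrier G" "r j \<in> R \<union> m_inv G ` R" using fr(1) by simp_all
    ultimately show ?r by blast
  next
    assume ?r
    then obtain w' g s where *: "conj_product G R j w'" "g \<in> carrier G" "s \<in> R \<union> m_inv G ` R"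
      "w = w' \<otimes> (inv g \<otimes> s \<otimes> g)" by blast
    then obtain f r where fr: "\<forall>i<j. f i \<in> carrier G \<and> r i \<in> R \<union> m_inv G ` R"
      "w' = list_mult G (map (\<lambda>i. inv (f i) \<otimes> r i \<otimes> f i) [0..<j])"
      unfolding conj_product_def by blast
    let ?f = "f(j := g)" and ?r = "r(j := s)"
    have eq: "map (\<lambda>i. inv (?f i) \<otimes> ?r i \<otimes> ?f i) [0..<j] = map (\<lambda>i. inv (f i) \<otimes> r i \<otimes> f i) [0..<j]"
      by auto
    have "w = list_mult G (map (\<lambda>i. inv (?f i) \<otimes> ?r i \<otimes> ?f i) [0..<Suc j])"
    proof -
      have "set (map (\<lambda>i. inv (f i) \<otimes> r i \<otimes> f i) [0..<j]) \<subseteq> carrier G"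
        using cl fr(1) by auto
      then show ?thesis
        using cl[OF *(2,3)] unfolding *(4) fr(2) upt_Suc_append[OF le0] map_append eq
        by (simp add: list_mult_append del: set_map)
    qed
    moreover have "\<forall>i<Suc j. ?f i \<in> carrier G \<and> ?r i \<in> R \<union> m_inv G ` R"
      using fr(1) *(2,3) by (auto simp: less_Suc_eq)
    ultimately show ?l unfolding conj_product_def by blast
  }
qed

context
  fixes R assumes R: "R \<subseteq> carrier G"
begin

lemma conj_product_closed: "conj_product G R j w \<Longrightarrow> w \<in> carrier G"
proof (induction j arbitrary: w)
  case (Suc j)
  then show ?case using R unfolding conj_product_Suc[OF R] by auto
qed (simp add: conj_product_0)

lemma conj_product_mult:
  "conj_product G R i v \<Longrightarrow> conj_product G R j w \<Longrightarrow> conj_product G R (i + j) (v \<otimes> w)"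
proof (induction j arbitrary: w)
  case 0
  then show ?case using conj_product_closed by (simp add: conj_product_0)
next
  case (Suc j)
  then obtain w' f r where *: "conj_product G R j w'" "f \<in> carrier G" "r \<in> R \<union> m_inv G ` R"
    "w = w' \<otimes> (inv f \<otimes> r \<otimes> f)" unfolding conj_product_Suc[OF R] by blast
  have "v \<otimes> w = (v \<otimes> w') \<otimes> (inv f \<otimes> r \<otimes> f)"
    using *(2,3) R conj_product_closed[OF *(1)] conj_product_closed[OF Suc(2)] unfolding *(4)
    by (subst m_assoc) auto
  then show ?case using Suc(1)[OF Suc(2) *(1)] *(2,3)
    unfolding add_Suc_right conj_product_Suc[OF R] by blast
qed

lemma conj_product_1:
  assumes "f \<in> carrier G" "r \<in> R \<union> m_inv G ` R"
  shows "conj_product G R (Suc 0) (inv f \<otimes> r \<otimes> f)"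
  unfolding conj_product_Suc[OF R] conj_product_0
  using assms R by (intro exI[of _ \<one>] exI[of _ f] exI[of _ r]) auto

lemma conj_product_inv: "conj_product G R j w \<Longrightarrow> conj_product G R j (inv w)"
proof (induction j arbitrary: w)
  case 0
  then show ?case by (simp add: conj_product_0)
next
  case (Suc j)
  then obtain w' f r where *: "conj_product G R j w'" "f \<in> carrier G" "r \<in> R \<union> m_inv G ` R"
    "w = w' \<otimes> (inv f \<otimes> r \<otimes> f)" unfolding conj_product_Suc[OF R] by blast
  have r: "r \<in> carrier G" "inv r \<in> R \<union> m_inv G ` R" using *(3) R by (auto simp: subset_iff)
  have "inv w = (inv f \<otimes> inv r \<otimes> f) \<otimes> inv w'"
    using *(2) r conj_product_closed[OF *(1)] unfolding *(4)
    by (simp add: inv_mult_group m_assoc)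
  then show ?case
    using conj_product_mult[OF conj_product_1[OF *(2) r(2)] Suc.IH[OF *(1)]] by simp
qed

lemma conj_product_conj:
  "conj_product G R j w \<Longrightarrow> g \<in> carrier G \<Longrightarrow> conj_product G R j (g \<otimes> w \<otimes> inv g)"
proof (induction j arbitrary: w)
  case 0
  then show ?case by (simp add: conj_product_0)
next
  case (Suc j)
  then obtain w' f r where *: "conj_product G R j w'" "f \<in> carrier G" "r \<in> R \<union> m_inv G ` R"
    "w = w' \<otimes> (inv f \<otimes> r \<otimes> f)" unfolding conj_product_Suc[OF R] by blast
  have r: "r \<in> carrier G" using *(3) R by auto
  have w': "w' \<in> carrier G" using *(1) by (rule conj_product_closed)
  let ?f = "f \<otimes> inv g"
  have "g \<otimes> w \<otimes> inv g = (g \<otimes> w' \<otimes> inv g) \<otimes> (inv ?f \<otimes> r \<otimes> ?f)"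
  proof -
    have "(g \<otimes> w' \<otimes> inv g) \<otimes> (inv ?f \<otimes> r \<otimes> ?f) = g \<otimes> w' \<otimes> (inv g \<otimes> g) \<otimes> inv f \<otimes> r \<otimes> f \<otimes> inv g"
      using *(2) r w' Suc(3) by (simp add: inv_mult_group m_assoc del: l_inv)
    then show ?thesis using *(2) r w' Suc(3) unfolding *(4) by (simp add: m_assoc)
  qed
  moreover have "?f \<in> carrier G" using *(2) Suc(3) by simp
  ultimately show ?case
    using Suc.IH[OF *(1) Suc(3)] *(3) unfolding conj_product_Suc[OF R] by blast
qed

text \<open>The products of conjugates form a normal subgroup that contains
  \<open>R\<close>.\<close>

lemma conj_product_normal_closure:
  assumes "w \<in> normal_closure G R"
  obtains j where "conj_product G R j w"
proof -
  let ?N = "{w. \<exists>j. conj_product G R j w}"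
  have sg: "subgroup ?N G"
  proof (rule subgroupI)
    show "?N \<noteq> {}" using conj_product_0 by blast
  qed (use conj_product_closed conj_product_mult conj_product_inv in blast)+
  have "?N \<lhd> G"
    using conj_product_conj by (intro normal_invI[OF sg]) blast
  moreover have "r \<in> ?N" if "r \<in> R" for r
    using conj_product_1[of \<one> r] that R by (auto simp: subset_iff)
  ultimately have "normal_closure G R \<subseteq> ?N" by (intro normal_closure_minimal) auto
  then show ?thesis using assms that by blast
qed

end

end

section \<open>Equality modulo relators with a count of the relators used\<close>

text \<open>The number \<open>c\<close> is exact, like \<open>j\<close> in
  \<open>conj_product\<close>, so that counts simply add up along a chain of replacements.\<close>

definition near :: "('g, 'm) monoid_scheme \<Rightarrow> 'g set \<Rightarrow> nat \<Rightarrow> 'g \<Rightarrow> 'g \<Rightarrow> bool" where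
  "near G R c g h \<longleftrightarrow> g \<in> carrier G \<and> h \<in> carrier G \<and> conj_product G R c (g \<otimes>\<^bsub>G\<^esub> inv\<^bsub>G\<^esub> h)"

context group
begin

context
  fixes R assumes R: "R \<subseteq> carrier G"
begin

lemma near_refl: "g \<in> carrier G \<Longrightarrow> near G R 0 g g"
  by (simp add: near_def conj_product_0)

lemma near_sym: "near G R c g h \<Longrightarrow> near G R c h g"
  unfolding near_def using conj_product_inv[OF R, of c "g \<otimes> inv h"]
  by (auto simp: inv_mult_group)

lemma near_trans: "near G R c g h \<Longrightarrow> near G R d h l \<Longrightarrow> near G R (c + d) g l"
  unfolding near_def using conj_product_mult[OF R, of c "g \<otimes> inv h" d "h \<otimes> inv l"]
  by (auto simp: m_assoc)

lemma near_lmult: "near G R c g h \<Longrightarrow> x \<in> carrier G \<Longrightarrow> near G R c (x \<otimes> g) (x \<otimes> h)"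
  unfolding near_def using conj_product_conj[OF R, of c "g \<otimes> inv h" x]
  by (auto simp: inv_mult_group m_assoc)

lemma near_rmult: "near G R c g h \<Longrightarrow> x \<in> carrier G \<Longrightarrow> near G R c (g \<otimes> x) (h \<otimes> x)"
proof -
  assume "near G R c g h" "x \<in> carrier G"
  moreover have "(g \<otimes> x) \<otimes> inv (h \<otimes> x) = g \<otimes> inv h"
    if "g \<in> carrier G" "h \<in> carrier G"
  proof -
    have "(g \<otimes> x) \<otimes> inv (h \<otimes> x) = g \<otimes> (x \<otimes> inv x) \<otimes> inv h"
      using that \<open>x \<in> carrier G\<close> by (simp add: inv_mult_group m_assoc del: r_inv)
    then show ?thesis using that \<open>x \<in> carrier G\<close> by simp
  qed
  ultimately show ?thesis unfolding near_def by auto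
qed

lemma near_mult:
  assumes "near G R c g h" "near G R d g' h'"
  shows "near G R (c + d) (g \<otimes> g') (h \<otimes> h')"
  using near_trans[OF near_rmult[OF assms(1), of g'] near_lmult[OF assms(2), of h]] assms
  by (auto simp: near_def)

lemma near_inv:
  assumes "near G R c g h" shows "near G R c (inv g) (inv h)"
proof -
  have gh: "g \<in> carrier G" "h \<in> carrier G" using assms by (auto simp: near_def)
  \<comment> \<open>The relation between \<open>h\<close> and \<open>g\<close> is multiplied by
    \<open>inv g\<close> on the left and by \<open>inv h\<close> on the right, which leaves the two
    inverses.\<close>
  have "near G R c (inv g \<otimes> (h \<otimes> inv h)) (inv g \<otimes> (g \<otimes> inv h))"
    using gh by (intro near_lmult near_rmult near_sym[OF assms]) auto
  then show ?thesis using gh by (simp add: m_assoc[symmetric])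
qed

lemma near_nat_pow: "near G R c g h \<Longrightarrow> near G R (n * c) (g [^] n) (h [^] n)"
proof (induction n)
  case 0
  then show ?case by (simp add: near_refl)
next
  case (Suc n)
  then show ?case using near_mult[OF Suc.IH[OF Suc.prems] Suc.prems] by (simp add: add.commute)
qed

text \<open>The factors of the power are replaced one at a time; this is the source of the cost of a
  pinch.\<close>

lemma near_int_pow: "near G R c g h \<Longrightarrow> near G R (nat \<bar>n\<bar> * c) (g [^] n) (h [^] (n::int))"
proof -
  assume *: "near G R c g h"
  show ?thesis
  proof (cases "n < 0")
    case True
    then show ?thesis using near_inv[OF near_nat_pow[OF *, of "nat (-n)"]]
      by (simp add: int_pow_def2 del: pow_nat)
  next
    case False
    then show ?thesis using near_nat_pow[OF *, of "nat n"] by simp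
  qed
qed

end
end

section \<open>Groups of permutations\<close>

definition perm_group :: "('x \<Rightarrow> 'x) monoid" where
  "perm_group = \<lparr>carrier = {f. bij f}, monoid.mult = (\<circ>), one = id\<rparr>"

lemma perm_group_simps [simp]:
  "f \<in> carrier perm_group \<longleftrightarrow> bij f" "f \<otimes>\<^bsub>perm_group\<^esub> g = f \<circ> g" "\<one>\<^bsub>perm_group\<^esub> = id"
  by (simp_all add: perm_group_def)

lemma group_perm_group: "group perm_group"
proof (rule groupI)
  fix f :: "'a \<Rightarrow> 'a" assume "f \<in> carrier perm_group"
  then show "\<exists>g\<in>carrier perm_group. g \<otimes>\<^bsub>perm_group\<^esub> f = \<one>\<^bsub>perm_group\<^esub>"
    by (intro bexI[of _ "inv_into UNIV f"]) (auto simp: bij_imp_bij_inv bij_is_inj)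
qed (auto simp: bij_comp comp_assoc)

lemma inv_perm_group: "bij f \<Longrightarrow> inv\<^bsub>perm_group\<^esub> f = inv_into UNIV f"
  by (rule group.inv_equality[OF group_perm_group]) (auto simp: bij_imp_bij_inv bij_is_inj)

text \<open>It identifies the explicit families \<open>shift\<close>, \<open>shear\<close> and
  \<open>rot\<close> with the powers of their values at 1, negative exponents included.\<close>

lemma (in group) one_parameter_int_pow:
  assumes "\<And>i. \<phi> i \<in> carrier G" "\<And>i j. \<phi> (i + j) = \<phi> i \<otimes> \<phi> j"
  shows "\<phi> 1 [^] (n::int) = \<phi> n"
proof -
  have 0: "\<phi> 0 = \<one>" using assms(1)[of 0] assms(2)[of 0 0] by simp
  show ?thesis
  proof (induction n rule: int_induct[of _ 0])
    case base
    then show ?case by (simp add: 0)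
  next
    case (step1 i)
    then show ?case using assms by (simp add: int_pow_mult)
  next
    case (step2 i)
    have "\<phi> (i - 1) \<otimes> \<phi> 1 = \<phi> i" using assms(2)[of "i - 1" 1] by simp
    moreover have "\<phi> 1 [^] (i - 1) \<otimes> \<phi> 1 = \<phi> i"
      using int_pow_mult[of "\<phi> 1" "i - 1" 1] assms(1) step2 by simp
    ultimately show ?case
      using assms(1) by (metis int_pow_closed right_cancel)
  qed
qed

section \<open>Baumslag--Solitar groups as quotients\<close>

abbreviation "bs_a \<equiv> free_gen UNIV Gen_a"
abbreviation "bs_t \<equiv> free_gen UNIV Gen_t"

locale baumslag_solitar =
  fixes k l :: int
  assumes k: "k \<noteq> 0" and l: "l \<noteq> 0"
begin

abbreviation "N \<equiv> normal_closure bs_free {bs_relator k l}"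
definition "proj w = N #>\<^bsub>bs_free\<^esub> w"
abbreviation "a \<equiv> proj bs_a"
abbreviation "t \<equiv> proj bs_t"
abbreviation "H \<equiv> generate (BS k l) {BS_t k l}"

sublocale F: group bs_free by (rule group_free_group)

lemma relator_closed: "bs_relator k l \<in> carrier bs_free"
  by (simp add: bs_relator_def Let_def)

sublocale N: normal N bs_free
  using relator_closed by (intro F.normal_closure_normal) simp

sublocale G: group "BS k l"
  unfolding BS_def by (rule N.factorgroup_is_group)

sublocale proj: group_hom bs_free "BS k l" proj
  unfolding BS_def proj_def using N.r_coset_hom_Mod N.factorgroup_is_group
  by (simp add: group_hom_def group_hom_axioms_def)

lemma proj_surj: "g \<in> carrier (BS k l) \<Longrightarrow> \<exists>w\<in>carrier bs_free. proj w = g"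
  by (auto simp: proj_def BS_def FactGroup_def RCOSETS_def)

lemma proj_eq_one_iff: "w \<in> carrier bs_free \<Longrightarrow> proj w = \<one>\<^bsub>BS k l\<^esub> \<longleftrightarrow> w \<in> N"
  using F.coset_join2[OF _ N.subgroup_axioms] F.rcos_self[OF _ N.subgroup_axioms]
  by (auto simp: proj_def BS_def FactGroup_def)

lemma BS_t_eq: "BS_t k l = t"
  by (simp add: BS_t_def proj_def)

lemma bs_relation: "t \<otimes>\<^bsub>BS k l\<^esub> a [^]\<^bsub>BS k l\<^esub> k \<otimes>\<^bsub>BS k l\<^esub> inv\<^bsub>BS k l\<^esub> t = a [^]\<^bsub>BS k l\<^esub> l"
proof -
  have "proj (bs_relator k l) = \<one>\<^bsub>BS k l\<^esub>"
    using relator_closed F.normal_closure_superset by (subst proj_eq_one_iff) auto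
  then have "t \<otimes>\<^bsub>BS k l\<^esub> a [^]\<^bsub>BS k l\<^esub> k \<otimes>\<^bsub>BS k l\<^esub> inv\<^bsub>BS k l\<^esub> t \<otimes>\<^bsub>BS k l\<^esub> inv\<^bsub>BS k l\<^esub> (a [^]\<^bsub>BS k l\<^esub> l) = \<one>\<^bsub>BS k l\<^esub>"
    unfolding bs_relator_def Let_def by (simp add: proj.hom_int_pow)
  then show ?thesis by (simp add: G.inv_solve_right')
qed

lemma H_eq: "H = range (\<lambda>i::int. t [^]\<^bsub>BS k l\<^esub> i)"
  using G.generate_pow[of t] unfolding BS_t_eq by auto

lemma subgroup_H: "subgroup H (BS k l)"
  unfolding BS_t_eq by (rule G.generate_is_subgroup) simp

text \<open>The preimage of \<open>M\<close> is a normal subgroup containing the relator. The uses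
  take for \<open>M\<close> the permutations that move finitely many fibres, the trivial subgroup,
  and a normal closure in a relative free group.\<close>

lemma lift_normal_closure:
  assumes "group K" "\<phi> \<in> hom bs_free K" "M \<lhd> K" "\<phi> (bs_relator k l) \<in> M" "w \<in> N"
  shows "\<phi> w \<in> M"
proof -
  interpret K: group K by fact
  interpret M: normal M K by fact
  interpret \<phi>: group_hom bs_free K \<phi>
    using assms by (simp add: group_hom_def group_hom_axioms_def F.is_group)
  let ?L = "{x \<in> carrier bs_free. \<phi> x \<in> M}"
  have "subgroup ?L bs_free"
    by (rule F.subgroupI) (auto intro: \<phi>.hom_one exI[of _ "\<one>\<^bsub>bs_free\<^esub>"])
  then have "?L \<lhd> bs_free"
    by (rule F.normal_invI) (auto simp: M.inv_op_closed2)
  then have "N \<subseteq> ?L"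
    using assms(4) relator_closed by (intro F.normal_closure_minimal) auto
  then show ?thesis using assms(5) by auto
qed

end

section \<open>Fibred permutations\<close>

text \<open>The translation \<open>c\<close> is the same over all fibres, so that conjugation merely
  translates the set \<open>moved\<close>.\<close>

definition fibred :: "(int \<times> 'v \<Rightarrow> int \<times> 'v) set" where
  "fibred = {g. bij g \<and> (\<exists>c. \<forall>p. fst (g p) = fst p + c)}"

definition fibred_group :: "(int \<times> 'v \<Rightarrow> int \<times> 'v) monoid" where
  "fibred_group = perm_group\<lparr>carrier := fibred\<rparr>"

definition moved :: "(int \<times> 'v \<Rightarrow> int \<times> 'v) \<Rightarrow> int set" where
  "moved g = {i. \<exists>v. g (i, v) \<noteq> (i, v)}"

lemma fibred_group_simps [simp]:
  "carrier fibred_group = fibred" "f \<otimes>\<^bsub>fibred_group\<^esub> g = f \<circ> g" "\<one>\<^bsub>fibred_group\<^esub> = id"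
  by (simp_all add: fibred_group_def)

lemma subgroup_fibred: "subgroup fibred perm_group"
proof (rule group.subgroupI[OF group_perm_group])
  show "fibred \<noteq> ({} :: (int \<times> 'v \<Rightarrow> int \<times> 'v) set)"
    by (auto simp: fibred_def intro!: exI[of _ id] exI[of _ 0])
  fix f :: "int \<times> 'v \<Rightarrow> int \<times> 'v" assume "f \<in> fibred"
  then obtain c where f: "bij f" "\<And>p. fst (f p) = fst p + c" by (auto simp: fibred_def)
  have "fst (inv_into UNIV f p) = fst p + (- c)" for p
    using f(2)[of "inv_into UNIV f p"] f(1) by (simp add: bij_is_surj surj_f_inv_f)
  then show "inv\<^bsub>perm_group\<^esub> f \<in> fibred"
    using f(1) by (auto simp: fibred_def inv_perm_group bij_imp_bij_inv)
  fix g :: "int \<times> 'v \<Rightarrow> int \<times> 'v" assume "g \<in> fibred"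
  then obtain d where g: "bij g" "\<And>p. fst (g p) = fst p + d" by (auto simp: fibred_def)
  have "fst (f (g p)) = fst p + (d + c)" for p using f(2) g(2) by simp
  then show "f \<otimes>\<^bsub>perm_group\<^esub> g \<in> fibred"
    using f(1) g(1) by (auto simp: fibred_def bij_comp)
qed (auto simp: fibred_def)

lemma group_fibred_group: "group fibred_group"
  unfolding fibred_group_def
  by (rule subgroup.subgroup_is_group[OF subgroup_fibred group_perm_group])

lemma inv_fibred_group: "g \<in> fibred \<Longrightarrow> inv\<^bsub>fibred_group\<^esub> g = inv_into UNIV g"
  using group.m_inv_consistent[OF group_perm_group subgroup_fibred, of g]
  by (simp add: fibred_group_def inv_perm_group fibred_def)

lemma moved_comp: "moved (g \<circ> h) \<subseteq> moved g \<union> moved h"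
  by (auto simp: moved_def)

lemma moved_inv:
  assumes "g \<in> fibred" shows "moved (inv\<^bsub>fibred_group\<^esub> g) \<subseteq> moved g"
proof -
  have "inj g" using assms by (simp add: fibred_def bij_is_inj)
  then have "g (i, v) \<noteq> (i, v)" if "inv_into UNIV g (i, v) \<noteq> (i, v)" for i v
    using that by (metis inv_f_f)
  then show ?thesis unfolding inv_fibred_group[OF assms] moved_def by auto
qed

text \<open>A fibre \<open>i\<close> moved by the conjugate is carried by \<open>f\<close> to the
  fibre \<open>i + c\<close>, which \<open>g\<close> must move; so a conjugate moves no more fibres
  than \<open>g\<close>.\<close>

lemma moved_conj:
  assumes "f \<in> fibred"
  obtains c where
    "moved (inv\<^bsub>fibred_group\<^esub> f \<otimes>\<^bsub>fibred_group\<^esub> g \<otimes>\<^bsub>fibred_group\<^esub> f) \<subseteq> (\<lambda>i. i - c) ` moved g"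
proof -
  obtain c where f: "bij f" "\<And>p. fst (f p) = fst p + c" using assms by (auto simp: fibred_def)
  have "i + c \<in> moved g" if "inv_into UNIV f (g (f (i, v))) \<noteq> (i, v)" for i v
  proof -
    have "f (i, v) = (i + c, snd (f (i, v)))" using f(2)[of "(i, v)"] by (simp add: prod_eq_iff)
    moreover have "g (f (i, v)) \<noteq> f (i, v)" using that f(1) by (auto simp: bij_is_inj)
    ultimately show ?thesis unfolding moved_def by (metis (mono_tags, lifting) mem_Collect_eq)
  qed
  then have "moved (inv_into UNIV f \<circ> g \<circ> f) \<subseteq> (\<lambda>i. i - c) ` moved g"
    by (fastforce simp: moved_def intro!: image_eqI[of _ _ "_ + c"])
  then show ?thesis using that[of c] assms by (simp add: inv_fibred_group)
qed

lemma finite_moved_normal: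
  "{g \<in> fibred. finite (moved g)} \<lhd> (fibred_group :: (int \<times> 'v \<Rightarrow> int \<times> 'v) monoid)"
proof -
  interpret group "fibred_group :: (int \<times> 'v \<Rightarrow> int \<times> 'v) monoid" by (rule group_fibred_group)
  let ?M = "{g \<in> fibred :: (int \<times> 'v \<Rightarrow> int \<times> 'v) set. finite (moved g)}"
  have sg: "subgroup ?M fibred_group"
  proof (rule subgroupI)
    show "?M \<noteq> {}" using one_closed by (auto simp: moved_def intro!: exI[of _ id])
    show "inv\<^bsub>fibred_group\<^esub> g \<in> ?M" if "g \<in> ?M" for g :: "int \<times> 'v \<Rightarrow> int \<times> 'v"
      using that moved_inv[of g] inv_closed[of g] by (auto intro: finite_subset)
    show "g \<otimes>\<^bsub>fibred_group\<^esub> h \<in> ?M" if "g \<in> ?M" "h \<in> ?M"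
      for g h :: "int \<times> 'v \<Rightarrow> int \<times> 'v"
      using that moved_comp[of g h] m_closed[of g h] by (auto intro: finite_subset)
  qed auto
  show ?thesis
  proof (rule normal_invI[OF sg])
    fix x h :: "int \<times> 'v \<Rightarrow> int \<times> 'v" assume x: "x \<in> carrier fibred_group" and h: "h \<in> ?M"
    then have "inv\<^bsub>fibred_group\<^esub> x \<in> fibred" using inv_closed[of x] by simp
    then obtain c where "moved (x \<otimes>\<^bsub>fibred_group\<^esub> h \<otimes>\<^bsub>fibred_group\<^esub> inv\<^bsub>fibred_group\<^esub> x)
        \<subseteq> (\<lambda>i. i - c) ` moved h"
      using moved_conj[of "inv\<^bsub>fibred_group\<^esub> x" h] inv_inv[OF x] by metis
    then have "finite (moved (x \<otimes>\<^bsub>fibred_group\<^esub> h \<otimes>\<^bsub>fibred_group\<^esub> inv\<^bsub>fibred_group\<^esub> x))"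
      using h by (auto intro: finite_subset)
    moreover have "x \<otimes>\<^bsub>fibred_group\<^esub> h \<otimes>\<^bsub>fibred_group\<^esub> inv\<^bsub>fibred_group\<^esub> x \<in> carrier fibred_group"
      using x h by (intro m_closed inv_closed) auto
    ultimately show "x \<otimes>\<^bsub>fibred_group\<^esub> h \<otimes>\<^bsub>fibred_group\<^esub> inv\<^bsub>fibred_group\<^esub> x \<in> ?M"
      by simp
  qed
qed

text \<open>Each conjugate of a relator or of its inverse contributes at most \<open>M\<close> moved
  fibres. Hence an element that moves many fibres needs many relators.\<close>

lemma card_moved_conj_product:
  assumes "group P" "\<Psi> \<in> hom P fibred_group" "R \<subseteq> carrier P"
    and M: "\<And>r. r \<in> R \<Longrightarrow> finite (moved (\<Psi> r)) \<and> card (moved (\<Psi> r)) \<le> M"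
    and "conj_product P R j w"
  shows "finite (moved (\<Psi> w)) \<and> card (moved (\<Psi> w)) \<le> j * M"
proof -
  interpret P: group P by fact
  interpret group_hom P fibred_group \<Psi>
    using assms(2) by (simp add: group_hom_def group_hom_axioms_def P.is_group group_fibred_group)
  have \<Psi>: "\<Psi> x \<in> fibred" if "x \<in> carrier P" for x using hom_closed[OF that] by simp
  show ?thesis using assms(5)
  proof (induction j arbitrary: w)
    case 0
    then show ?case using hom_one by (simp add: P.conj_product_0 moved_def)
  next
    case (Suc j)
    then obtain w' f r where *: "conj_product P R j w'" "f \<in> carrier P" "r \<in> R \<union> m_inv P ` R"
      "w = w' \<otimes>\<^bsub>P\<^esub> (inv\<^bsub>P\<^esub> f \<otimes>\<^bsub>P\<^esub> r \<otimes>\<^bsub>P\<^esub> f)"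
      unfolding P.conj_product_Suc[OF assms(3)] by blast
    have w': "w' \<in> carrier P" by (rule P.conj_product_closed[OF assms(3) *(1)])
    have r: "r \<in> carrier P" using *(3) assms(3) by auto
    have Mr: "finite (moved (\<Psi> r)) \<and> card (moved (\<Psi> r)) \<le> M"
    proof (cases "r \<in> R")
      case False
      then obtain s where s: "s \<in> R" "r = inv\<^bsub>P\<^esub> s" using *(3) by auto
      then have "moved (\<Psi> r) \<subseteq> moved (\<Psi> s)"
        using moved_inv[OF \<Psi>[of s]] hom_inv[of s] subsetD[OF assms(3) s(1)] by simp
      then show ?thesis using M[OF s(1)] by (meson card_mono finite_subset le_trans)
    qed (use M in blast)
    obtain c where "moved (inv\<^bsub>fibred_group\<^esub> \<Psi> f \<otimes>\<^bsub>fibred_group\<^esub> \<Psi> r \<otimes>\<^bsub>fibred_group\<^esub> \<Psi> f)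
        \<subseteq> (\<lambda>i. i - c) ` moved (\<Psi> r)"
      using moved_conj[OF \<Psi>[OF *(2)]] by metis
    moreover have "\<Psi> (inv\<^bsub>P\<^esub> f \<otimes>\<^bsub>P\<^esub> r \<otimes>\<^bsub>P\<^esub> f) =
        inv\<^bsub>fibred_group\<^esub> \<Psi> f \<otimes>\<^bsub>fibred_group\<^esub> \<Psi> r \<otimes>\<^bsub>fibred_group\<^esub> \<Psi> f"
      using *(2) r by (simp only: hom_mult hom_inv P.m_closed P.inv_closed)
    moreover have "\<Psi> w = \<Psi> w' \<circ> \<Psi> (inv\<^bsub>P\<^esub> f \<otimes>\<^bsub>P\<^esub> r \<otimes>\<^bsub>P\<^esub> f)"
      using hom_mult[OF w', of "inv\<^bsub>P\<^esub> f \<otimes>\<^bsub>P\<^esub> r \<otimes>\<^bsub>P\<^esub> f"] *(2) r unfolding *(4) by simp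
    ultimately have sub: "moved (\<Psi> w) \<subseteq> moved (\<Psi> w') \<union> (\<lambda>i. i - c) ` moved (\<Psi> r)"
      using moved_comp[of "\<Psi> w'" "\<Psi> (inv\<^bsub>P\<^esub> f \<otimes>\<^bsub>P\<^esub> r \<otimes>\<^bsub>P\<^esub> f)"] by auto
    have fin: "finite (moved (\<Psi> w') \<union> (\<lambda>i. i - c) ` moved (\<Psi> r))"
      using Mr Suc.IH[OF *(1)] by simp
    have "card (moved (\<Psi> w)) \<le> card (moved (\<Psi> w')) + card ((\<lambda>i. i - c) ` moved (\<Psi> r))"
      using card_mono[OF fin sub] card_Un_le le_trans by blast
    also have "\<dots> \<le> j * M + M"
      using Mr Suc.IH[OF *(1)] by (meson add_mono card_image_le le_trans)
    finally show ?case using finite_subset[OF sub fin] by simp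
  qed
qed

section \<open>A representation by shifts and shears\<close>

definition shift :: "int \<Rightarrow> int \<times> rat \<times> rat \<Rightarrow> int \<times> rat \<times> rat" where
  "shift n = (\<lambda>(i, v). (i + n, v))"

lemma shift_add: "shift (m + n) = shift m \<circ> shift n"
  by (auto simp: shift_def)

lemma shift_fibred [simp]: "shift n \<in> fibred"
proof -
  have "bij (shift n)" by (rule o_bij[of "shift (- n)"]) (auto simp: shift_def)
  moreover have "\<forall>p. fst (shift n p) = fst p + n" by (auto simp: shift_def)
  ultimately show ?thesis unfolding fibred_def by blast
qed

lemma moved_shift: "n \<noteq> 0 \<Longrightarrow> moved (shift n) = UNIV"
  by (auto simp: moved_def shift_def)

lemma inv_shift: "inv\<^bsub>fibred_group\<^esub> shift n = shift (- n)"
  by (rule group.inv_equality[OF group_fibred_group]) (simp_all, auto simp: shift_def)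

context baumslag_solitar
begin

text \<open>The ratio of the amounts over neighbouring fibres is chosen so that t a^k t^-1 and a^l
  agree wherever the direction of the shear does not change, that is, away from fibre 0.\<close>

definition shear :: "int \<Rightarrow> int \<times> rat \<times> rat \<Rightarrow> int \<times> rat \<times> rat" where
  "shear n = (\<lambda>(i, x, y).
     let c = of_int n * (of_int k / of_int l) powi i
     in if i < 0 then (i, x + c * y, y) else (i, x, y + c * x))"

lemma shear_add: "shear (m + n) = shear m \<circ> shear n"
  by (auto simp: shear_def Let_def algebra_simps)

lemma shear_fibred [simp]: "shear n \<in> fibred"
proof -
  have "shear (- n) \<circ> shear n = id" "shear n \<circ> shear (- n) = id"
    unfolding shear_add[symmetric] by (auto simp: shear_def Let_def)
  then have "bij (shear n)" by (rule o_bij)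
  moreover have "\<forall>p. fst (shear n p) = fst p + 0" by (auto simp: shear_def Let_def)
  ultimately show ?thesis unfolding fibred_def by blast
qed

lemma shear_fst [simp]: "fst (shear n p) = fst p"
  by (cases p) (simp add: shear_def Let_def)

definition \<psi> where "\<psi> = free_group_lift fibred_group (case_bs_gen (shear 1) (shift 1))"

lemma \<psi>_hom: "\<psi> \<in> hom bs_free fibred_group"
  and \<psi>_a: "\<psi> bs_a = shear 1"
  and \<psi>_t: "\<psi> bs_t = shift 1"
proof -
  have "case_bs_gen (shear 1) (shift 1) \<in> UNIV \<rightarrow> carrier fibred_group"
    by (auto split: bs_gen.split)
  note free_group_lift[OF group_fibred_group this, folded \<psi>_def]
  then show "\<psi> \<in> hom bs_free fibred_group" "\<psi> bs_a = shear 1" "\<psi> bs_t = shift 1"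
    by simp_all
qed

sublocale \<psi>: group_hom bs_free fibred_group \<psi>
  by (intro group_hom.intro group_hom_axioms.intro \<psi>_hom group_fibred_group F.is_group)

lemma \<psi>_a_pow: "\<psi> (bs_a [^]\<^bsub>bs_free\<^esub> (n::int)) = shear n"
  using \<psi>.H.one_parameter_int_pow[of shear n] by (simp add: \<psi>.hom_int_pow \<psi>_a shear_add)

lemma \<psi>_t_pow: "\<psi> (bs_t [^]\<^bsub>bs_free\<^esub> (n::int)) = shift n"
  using \<psi>.H.one_parameter_int_pow[of shift n] by (simp add: \<psi>.hom_int_pow \<psi>_t shift_add)

text \<open>Over fibre \<open>i\<close> the conjugate t a^k t^-1 shears as a^k does over fibre
  \<open>i - 1\<close>. The amounts agree with those of a^l, and for \<open>i \<noteq> 0\<close> the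
  two fibres lie on the same side of the change of direction.\<close>

lemma moved_relator: "moved (\<psi> (bs_relator k l)) \<subseteq> {0}"
proof -
  let ?\<rho> = "of_int k / of_int l :: rat"
  have eq: "\<psi> (bs_relator k l) = shift 1 \<circ> shear k \<circ> shift (- 1) \<circ> shear (- l)"
  proof -
    have "inv\<^bsub>bs_free\<^esub> (bs_a [^]\<^bsub>bs_free\<^esub> l) = bs_a [^]\<^bsub>bs_free\<^esub> (- l)"
      by (simp add: F.int_pow_neg)
    then show ?thesis unfolding bs_relator_def Let_def
      by (simp del: \<psi>.hom_int_pow add: \<psi>_a_pow \<psi>_t inv_shift)
  qed
  have "\<psi> (bs_relator k l) (i, v) = (i, v)" if "i \<noteq> 0" for i v
  proof -
    have "of_int l * ?\<rho> powi i = of_int k * ?\<rho> powi (i - 1)"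
    proof -
      have "?\<rho> powi (i - 1) = ?\<rho> powi i / ?\<rho>" using k l by (subst power_int_diff) auto
      then show ?thesis using k l by (simp only:) simp
    qed
    moreover have "i - 1 < 0 \<longleftrightarrow> i < 0" using that by auto
    ultimately show ?thesis unfolding eq
      by (cases v) (auto simp: shift_def shear_def Let_def algebra_simps)
  qed
  then show ?thesis by (auto simp: moved_def)
qed

lemma moved_N:
  assumes "w \<in> N" shows "finite (moved (\<psi> w))"
  using lift_normal_closure[OF group_fibred_group \<psi>_hom finite_moved_normal _ assms]
    moved_relator \<psi>.hom_closed[OF relator_closed]
  by (auto intro: finite_subset)

text \<open>A non-zero shift moves every fibre, whereas elements of \<open>N\<close> move finitely
  many. So \<open>H\<close> is infinite cyclic and exponents of its elements are well
  defined.\<close>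

lemma t_pow_inj:
  assumes "t [^]\<^bsub>BS k l\<^esub> (i::int) = t [^]\<^bsub>BS k l\<^esub> (j::int)"
  shows "i = j"
proof (rule ccontr)
  assume "i \<noteq> j"
  have "proj (bs_t [^]\<^bsub>bs_free\<^esub> (i - j)) = \<one>\<^bsub>BS k l\<^esub>"
    using assms by (simp add: proj.hom_int_pow G.int_pow_diff)
  then have "bs_t [^]\<^bsub>bs_free\<^esub> (i - j) \<in> N" by (simp add: proj_eq_one_iff del: proj.hom_int_pow)
  from moved_N[OF this] \<open>i \<noteq> j\<close> show False
    using infinite_UNIV_int by (simp add: \<psi>_t_pow moved_shift del: \<psi>.hom_int_pow)
qed

text \<open>Over fibre \<open>i\<close> the two sides are products, in opposite orders, of a lower and an upper
  unitriangular matrix.\<close>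

lemma shear_not_commute:
  assumes "0 \<le> i" "i < m" "d \<noteq> 0"
  shows "shift m (shear d (shift (- m) (shear d (i, 1, 0)))) \<noteq>
    shear d (shift m (shear d (shift (- m) (i, 1, 0))))"
  using assms k l by (simp add: shift_def shear_def Let_def)

text \<open>\<open>B\<close> is only a perturbed shear, because the lift of a power of
  \<open>a\<close> to an arbitrary presentation is known up to elements of \<open>N\<close>. The
  perturbation spoils the fibres in \<open>T\<close> for \<open>B\<close> and those in
  \<open>T\<close> translated by \<open>m\<close> for \<open>X\<close>.\<close>

lemma moved_commutator:
  fixes m :: nat and B X :: "int \<times> rat \<times> rat \<Rightarrow> int \<times> rat \<times> rat"
  defines "X \<equiv> shift (int m) \<otimes>\<^bsub>fibred_group\<^esub> B \<otimes>\<^bsub>fibred_group\<^esub> shift (- int m)"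
  defines "C \<equiv> X \<otimes>\<^bsub>fibred_group\<^esub> B \<otimes>\<^bsub>fibred_group\<^esub> inv\<^bsub>fibred_group\<^esub> X \<otimes>\<^bsub>fibred_group\<^esub> inv\<^bsub>fibred_group\<^esub> B"
  assumes B: "B \<in> fibred" and T: "finite T" "\<And>i v. i \<notin> T \<Longrightarrow> B (i, v) = shear d (i, v)"
    and d: "d \<noteq> 0" and fin: "finite (moved C)"
  shows "m \<le> card (moved C) + 2 * card T"
proof -
  have X: "X \<in> carrier fibred_group" unfolding X_def
    using B by (intro \<psi>.H.m_closed) auto
  have "C \<in> carrier fibred_group"
    unfolding C_def using B X by (intro \<psi>.H.m_closed \<psi>.H.inv_closed) auto
  \<comment> \<open>\<open>C\<close> is the commutator of \<open>X\<close> and \<open>B\<close>, so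
    wherever \<open>X (B p)\<close> and \<open>B (X p)\<close> differ, \<open>C\<close> moves the
    point \<open>B (X p)\<close>.\<close>
  have "C \<otimes>\<^bsub>fibred_group\<^esub> (B \<otimes>\<^bsub>fibred_group\<^esub> X) = X \<otimes>\<^bsub>fibred_group\<^esub> B"
    using B X \<psi>.H.m_assoc \<psi>.H.l_inv \<psi>.H.r_one \<psi>.H.mult_inv_cancel_left \<psi>.H.m_closed \<psi>.H.inv_closed
    unfolding C_def by (simp del: fibred_group_simps(2,3) add: \<psi>.H.m_assoc)
  then have C: "C (B (X p)) = X (B p)" for p by (metis comp_apply fibred_group_simps(2))
  \<comment> \<open>Over fibre \<open>i\<close>, \<open>X\<close> acts as \<open>B\<close> does over
    fibre \<open>i - m\<close>, so both must avoid \<open>T\<close>. They lie on different sides of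
    0, where the shears have different directions.\<close>
  have "i \<in> moved C" if i: "i \<in> {0..<int m}" "i \<notin> T" "i - int m \<notin> T" for i
  proof -
    have Xs: "X (i, v) = shift (int m) (shear d (shift (- int m) (i, v)))" for v
      using T(2)[OF i(3)] by (simp add: X_def shift_def)
    have Bs: "B (i, v) = shear d (i, v)" for v by (rule T(2)[OF i(2)])
    have f: "(i, snd p) = p" if "fst p = i" for p :: "int \<times> rat \<times> rat" using that by auto
    have f1: "fst (shear d (i, v)) = i" for v by simp
    have f2: "fst (X (i, v)) = i" for v unfolding Xs
      by (simp add: shift_def case_prod_beta)
    have XB: "X (B (i, v)) = shift (int m) (shear d (shift (- int m) (shear d (i, v))))" for v
      unfolding Bs using Xs[of "snd (shear d (i, v))"] f[OF f1[of v]] by simp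
    have BX: "B (X (i, v)) = shear d (shift (int m) (shear d (shift (- int m) (i, v))))" for v
      using Bs[of "snd (X (i, v))"] f[OF f2[of v]] Xs[of v] by simp
    have "X (B (i, 1, 0)) \<noteq> B (X (i, 1, 0))"
      unfolding XB BX using i d by (intro shear_not_commute) auto
    then have "C (B (X (i, 1, 0))) \<noteq> B (X (i, 1, 0))" by (simp only: C not_False_eq_True)
    moreover have "fst (B (X (i, 1, 0))) = i"
      using Bs[of "snd (X (i, 1, 0))"] f[OF f2[of "(1, 0)"]] f2 by simp
    ultimately show ?thesis using f unfolding moved_def by (metis (mono_tags, lifting) mem_Collect_eq)
  qed
  then have "{0..<int m} \<subseteq> moved C \<union> (T \<union> (\<lambda>i. i + int m) ` T)"
    by (force intro!: image_eqI[of _ "\<lambda>i. i + int m" "_ - int m"])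
  then have "m \<le> card (moved C \<union> (T \<union> (\<lambda>i. i + int m) ` T))"
    using card_mono[of "moved C \<union> (T \<union> (\<lambda>i. i + int m) ` T)" "{0..<int m}"] fin T(1) by simp
  also have "\<dots> \<le> card (moved C) + (card T + card ((\<lambda>i. i + int m) ` T))"
    using card_Un_le by (meson add_left_mono le_trans)
  also have "\<dots> \<le> card (moved C) + 2 * card T"
    using card_image_le[OF T(1), of "\<lambda>i. i + int m"] by simp
  finally show ?thesis .
qed


section \<open>Commuting conjugates when one exponent divides the other\<close>

text \<open>Conjugation by a power of \<open>x\<close> is an endomorphism, so each further
  conjugation multiplies the exponent by \<open>q\<close>. Being a power of \<open>y\<close>, the
  conjugate commutes with \<open>y\<close>.\<close>

lemma conjugate_pow_commute:
  fixes K (structure)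
  assumes "group K" "x \<in> carrier K" "y \<in> carrier K" and rel: "x \<otimes> y \<otimes> inv x = y [^] (q::int)"
  shows "\<exists>e::int. x [^] (m::nat) \<otimes> y \<otimes> inv (x [^] m) = y [^] e"
proof -
  interpret group K by fact
  show ?thesis
  proof (induction m)
    case 0
    then show ?case using assms(3) by (intro exI[of _ 1]) simp
  next
    case (Suc m)
    then obtain e :: int where e: "x [^] m \<otimes> y \<otimes> inv (x [^] m) = y [^] e" by blast
    interpret c: group_hom K K "\<lambda>z. x [^] m \<otimes> z \<otimes> inv (x [^] m)"
      by unfold_locales (use assms(2) in \<open>auto simp: hom_def m_assoc\<close>)
    have "x [^] Suc m \<otimes> y \<otimes> inv (x [^] Suc m) = x [^] m \<otimes> (x \<otimes> y \<otimes> inv x) \<otimes> inv (x [^] m)"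
      using assms(2,3) by (simp add: inv_mult_group m_assoc)
    also have "\<dots> = y [^] (e * q)"
      using c.hom_int_pow[of y q] assms(3) by (simp add: rel e int_pow_pow)
    finally show ?case by blast
  qed
qed

text \<open>If \<open>k\<close> divides \<open>l\<close>, take \<open>d = k\<close>, as
  \<open>t\<close> conjugates a^k to a power of itself. If \<open>l\<close> divides
  \<open>k\<close>, take \<open>d = l\<close>, for which the inverse of \<open>t\<close> does the
  same.\<close>

lemma commuting_conjugates:
  assumes "k dvd l \<or> l dvd k"
  obtains d :: int where "d \<noteq> 0"
    "\<And>m::nat. t [^]\<^bsub>BS k l\<^esub> m \<otimes>\<^bsub>BS k l\<^esub> a [^]\<^bsub>BS k l\<^esub> d \<otimes>\<^bsub>BS k l\<^esub> inv\<^bsub>BS k l\<^esub> (t [^]\<^bsub>BS k l\<^esub> m) \<otimes>\<^bsub>BS k l\<^esub> a [^]\<^bsub>BS k l\<^esub> d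
      = a [^]\<^bsub>BS k l\<^esub> d \<otimes>\<^bsub>BS k l\<^esub> (t [^]\<^bsub>BS k l\<^esub> m \<otimes>\<^bsub>BS k l\<^esub> a [^]\<^bsub>BS k l\<^esub> d \<otimes>\<^bsub>BS k l\<^esub> inv\<^bsub>BS k l\<^esub> (t [^]\<^bsub>BS k l\<^esub> m))"
  using assms
proof
  assume "k dvd l"
  then obtain q where q: "l = k * q" by blast
  have rel: "t \<otimes>\<^bsub>BS k l\<^esub> a [^]\<^bsub>BS k l\<^esub> k \<otimes>\<^bsub>BS k l\<^esub> inv\<^bsub>BS k l\<^esub> t = (a [^]\<^bsub>BS k l\<^esub> k) [^]\<^bsub>BS k l\<^esub> q"
    by (simp add: G.int_pow_pow bs_relation flip: q)
  have "\<exists>e::int. t [^]\<^bsub>BS k l\<^esub> m \<otimes>\<^bsub>BS k l\<^esub> a [^]\<^bsub>BS k l\<^esub> k \<otimes>\<^bsub>BS k l\<^esub> inv\<^bsub>BS k l\<^esub> (t [^]\<^bsub>BS k l\<^esub> m) = (a [^]\<^bsub>BS k l\<^esub> k) [^]\<^bsub>BS k l\<^esub> e"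
    for m :: nat
    by (rule conjugate_pow_commute[OF G.is_group _ _ rel]) simp_all
  note e = this
  show ?thesis
  proof (rule that[OF k])
    fix m :: nat
    let ?A = "a [^]\<^bsub>BS k l\<^esub> k"
    obtain e :: int where
      "t [^]\<^bsub>BS k l\<^esub> m \<otimes>\<^bsub>BS k l\<^esub> ?A \<otimes>\<^bsub>BS k l\<^esub> inv\<^bsub>BS k l\<^esub> (t [^]\<^bsub>BS k l\<^esub> m) = ?A [^]\<^bsub>BS k l\<^esub> e"
      using e[of m] by blast
    then show "t [^]\<^bsub>BS k l\<^esub> m \<otimes>\<^bsub>BS k l\<^esub> ?A \<otimes>\<^bsub>BS k l\<^esub> inv\<^bsub>BS k l\<^esub> (t [^]\<^bsub>BS k l\<^esub> m) \<otimes>\<^bsub>BS k l\<^esub> ?A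
      = ?A \<otimes>\<^bsub>BS k l\<^esub> (t [^]\<^bsub>BS k l\<^esub> m \<otimes>\<^bsub>BS k l\<^esub> ?A \<otimes>\<^bsub>BS k l\<^esub> inv\<^bsub>BS k l\<^esub> (t [^]\<^bsub>BS k l\<^esub> m))"
      using G.int_pow_mult[of ?A 1 e] G.int_pow_mult[of ?A e 1] by (simp add: add.commute)
  qed
next
  assume "l dvd k"
  then obtain q where q: "k = l * q" by blast
  have "inv\<^bsub>BS k l\<^esub> t \<otimes>\<^bsub>BS k l\<^esub> a [^]\<^bsub>BS k l\<^esub> l \<otimes>\<^bsub>BS k l\<^esub> t = a [^]\<^bsub>BS k l\<^esub> k"
    unfolding bs_relation[symmetric] by (simp add: G.m_assoc)
  then have rel: "inv\<^bsub>BS k l\<^esub> t \<otimes>\<^bsub>BS k l\<^esub> a [^]\<^bsub>BS k l\<^esub> l \<otimes>\<^bsub>BS k l\<^esub> inv\<^bsub>BS k l\<^esub> (inv\<^bsub>BS k l\<^esub> t) = (a [^]\<^bsub>BS k l\<^esub> l) [^]\<^bsub>BS k l\<^esub> q"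
    by (simp add: G.int_pow_pow flip: q)
  show ?thesis
  proof (rule that[OF l])
    fix m :: nat
    let ?T = "t [^]\<^bsub>BS k l\<^esub> m" and ?A = "a [^]\<^bsub>BS k l\<^esub> l"
    obtain e :: int where "inv\<^bsub>BS k l\<^esub> t [^]\<^bsub>BS k l\<^esub> m \<otimes>\<^bsub>BS k l\<^esub> ?A \<otimes>\<^bsub>BS k l\<^esub> inv\<^bsub>BS k l\<^esub> (inv\<^bsub>BS k l\<^esub> t [^]\<^bsub>BS k l\<^esub> m) = ?A [^]\<^bsub>BS k l\<^esub> e"
      using conjugate_pow_commute[OF G.is_group _ _ rel, of m] by auto
    then have e: "inv\<^bsub>BS k l\<^esub> ?T \<otimes>\<^bsub>BS k l\<^esub> ?A \<otimes>\<^bsub>BS k l\<^esub> ?T = ?A [^]\<^bsub>BS k l\<^esub> e"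
      by (simp flip: G.nat_pow_inv)
    \<comment> \<open>Here it is the conjugate by t^-m that is a power of \<open>?A\<close>. It
      commutes with \<open>?A\<close>, and conjugating this identity by t^m gives the claim.\<close>
    have "?T \<otimes>\<^bsub>BS k l\<^esub> ?A \<otimes>\<^bsub>BS k l\<^esub> inv\<^bsub>BS k l\<^esub> ?T \<otimes>\<^bsub>BS k l\<^esub> ?A
        = ?T \<otimes>\<^bsub>BS k l\<^esub> (?A \<otimes>\<^bsub>BS k l\<^esub> (inv\<^bsub>BS k l\<^esub> ?T \<otimes>\<^bsub>BS k l\<^esub> ?A \<otimes>\<^bsub>BS k l\<^esub> ?T)) \<otimes>\<^bsub>BS k l\<^esub> inv\<^bsub>BS k l\<^esub> ?T"
      by (simp add: G.m_assoc)
    also have "?A \<otimes>\<^bsub>BS k l\<^esub> (inv\<^bsub>BS k l\<^esub> ?T \<otimes>\<^bsub>BS k l\<^esub> ?A \<otimes>\<^bsub>BS k l\<^esub> ?T) = (inv\<^bsub>BS k l\<^esub> ?T \<otimes>\<^bsub>BS k l\<^esub> ?A \<otimes>\<^bsub>BS k l\<^esub> ?T) \<otimes>\<^bsub>BS k l\<^esub> ?A"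
      using G.int_pow_mult[of ?A 1 e] G.int_pow_mult[of ?A e 1] unfolding e by (simp add: add.commute)
    also have "?T \<otimes>\<^bsub>BS k l\<^esub> ((inv\<^bsub>BS k l\<^esub> ?T \<otimes>\<^bsub>BS k l\<^esub> ?A \<otimes>\<^bsub>BS k l\<^esub> ?T) \<otimes>\<^bsub>BS k l\<^esub> ?A) \<otimes>\<^bsub>BS k l\<^esub> inv\<^bsub>BS k l\<^esub> ?T
        = ?A \<otimes>\<^bsub>BS k l\<^esub> (?T \<otimes>\<^bsub>BS k l\<^esub> ?A \<otimes>\<^bsub>BS k l\<^esub> inv\<^bsub>BS k l\<^esub> ?T)"
      by (simp add: G.m_assoc)
    finally show "?T \<otimes>\<^bsub>BS k l\<^esub> ?A \<otimes>\<^bsub>BS k l\<^esub> inv\<^bsub>BS k l\<^esub> ?T \<otimes>\<^bsub>BS k l\<^esub> ?A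
        = ?A \<otimes>\<^bsub>BS k l\<^esub> (?T \<otimes>\<^bsub>BS k l\<^esub> ?A \<otimes>\<^bsub>BS k l\<^esub> inv\<^bsub>BS k l\<^esub> ?T)" .
  qed
qed


section \<open>Unbounded area in the case of divisibility\<close>

lemma not_well_defined:
  assumes "k dvd l \<or> l dvd k"
  shows "\<not> rel_dehn_well_defined (BS k l) H"
proof
  assume "rel_dehn_well_defined (BS k l) H"
  then obtain S R where SR: "rel_presentation (BS k l) H S R" "finite S" "finite R"
    and dehn: "\<And>n. rel_dehn (BS k l) H S R n \<noteq> \<infinity>"
    unfolding rel_dehn_well_defined_def finite_rel_presentation_def by blast
  interpret relative_group "BS k l" H S
    using SR(1) subgroup_H
    by (intro relative_group.intro relative_group_axioms.intro G.is_group)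
      (auto simp: rel_presentation_def generated_rel_def)
  have R: "R \<subseteq> carrier P"
    and ker: "normal_closure P R = kernel P (BS k l) (rel_hom (BS k l))"
    and surj: "rel_hom (BS k l) ` carrier P = carrier (BS k l)"
    using SR(1) by (auto simp: rel_presentation_def generated_rel_def)

  \<comment> \<open>The presentation is arbitrary, so the action is pulled back to its free product
    \<open>P\<close>: elements of \<open>S\<close> are lifted to \<open>bs_free\<close> by choice,
    powers of \<open>t\<close> by their exponent.\<close>
  define \<sigma> where "\<sigma> s = (SOME w. w \<in> carrier bs_free \<and> proj w = s)" for s
  have \<sigma>: "\<sigma> s \<in> carrier bs_free" "proj (\<sigma> s) = s" if "s \<in> carrier (BS k l)" for s
    using someI_ex[of "\<lambda>w. w \<in> carrier bs_free \<and> proj w = s"] proj_surj[OF that]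
    by (auto simp: \<sigma>_def)
  \<comment> \<open>The choice is unique since \<open>t\<close> has infinite order; this makes
    \<open>\<eta>\<close> a homomorphism.\<close>
  define ex where "ex h = (SOME i::int. t [^]\<^bsub>BS k l\<^esub> i = h)" for h
  have ex: "ex (t [^]\<^bsub>BS k l\<^esub> i) = i" for i :: int
    unfolding ex_def by (rule some_equality) (auto dest: t_pow_inj)
  define \<eta> where "\<eta> h = bs_t [^]\<^bsub>bs_free\<^esub> ex h" for h
  have \<eta>: "\<eta> \<in> hom ((BS k l)\<lparr>carrier := H\<rparr>) bs_free"
  proof (rule homI)
    fix g h assume "g \<in> carrier ((BS k l)\<lparr>carrier := H\<rparr>)" "h \<in> carrier ((BS k l)\<lparr>carrier := H\<rparr>)"
    then obtain i j :: int where ij: "g = t [^]\<^bsub>BS k l\<^esub> i" "h = t [^]\<^bsub>BS k l\<^esub> j"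
      by (auto simp: H_eq)
    have "ex (g \<otimes>\<^bsub>BS k l\<^esub> h) = i + j"
      unfolding ij by (simp add: ex flip: G.int_pow_mult)
    then show "\<eta> (g \<otimes>\<^bsub>(BS k l)\<lparr>carrier := H\<rparr>\<^esub> h) = \<eta> g \<otimes>\<^bsub>bs_free\<^esub> \<eta> h"
      by (simp add: \<eta>_def ij ex F.int_pow_mult)
  qed (simp add: \<eta>_def)
  have \<sigma>_S: "\<sigma> \<in> S \<rightarrow> carrier bs_free" using \<sigma> S_closed by auto
  define \<Phi> where "\<Phi> = free_product_lift bs_free (free_group_lift bs_free \<sigma>) \<eta>"
  note \<Phi>_lift = rel_free_lift[OF F.is_group \<sigma>_S \<eta>, folded \<Phi>_def]
  interpret \<Phi>: group_hom P bs_free \<Phi>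
    by (intro group_hom.intro group_hom_axioms.intro \<Phi>_lift(1) P.is_group F.is_group)
  \<comment> \<open>\<open>\<Phi>\<close> lifts \<open>rel_hom\<close> through \<open>proj\<close>,
    hence maps relators into \<open>N\<close>.\<close>
  have proj_\<Phi>: "proj (\<Phi> w) = rel_hom (BS k l) w" if "w \<in> carrier P" for w
  proof -
    have "(proj \<circ> \<Phi>) w = rel_hom (BS k l) w"
    proof (rule rel_free_hom_eqI[OF G.is_group _ rel_hom_hom _ _ that])
      show "proj \<circ> \<Phi> \<in> hom P (BS k l)"
        using \<Phi>.homh proj.homh by (rule hom_compose)
      show "(proj \<circ> \<Phi>) (gen s) = rel_hom (BS k l) (gen s)" if "s \<in> S" for s
        using that \<sigma>(2) S_closed by (auto simp: \<Phi>_lift(2) rel_hom_gen)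
      show "(proj \<circ> \<Phi>) (inc h) = rel_hom (BS k l) (inc h)" if "h \<in> H" for h
      proof -
        from that obtain i :: int where "h = t [^]\<^bsub>BS k l\<^esub> i" using H_eq by blast
        then show ?thesis
          using that by (simp add: \<Phi>_lift(3) rel_hom_inc \<eta>_def ex proj.hom_int_pow)
      qed
    qed
    then show ?thesis by simp
  qed

  define \<Psi> where "\<Psi> = \<psi> \<circ> \<Phi>"
  have \<Psi>_hom: "\<Psi> \<in> hom P fibred_group"
    unfolding \<Psi>_def using \<Phi>.homh \<psi>.homh by (rule hom_compose)
  interpret \<Psi>: group_hom P fibred_group \<Psi>
    by (intro group_hom.intro group_hom_axioms.intro \<Psi>_hom P.is_group group_fibred_group)
  \<comment> \<open>As \<open>R\<close> is finite, the sum bounds the number of fibres moved by any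
    single relator.\<close>
  define M where "M = (\<Sum>r\<in>R. card (moved (\<Psi> r)))"
  have M: "finite (moved (\<Psi> r)) \<and> card (moved (\<Psi> r)) \<le> M" if "r \<in> R" for r
  proof
    have "r \<in> normal_closure P R" using that P.normal_closure_superset by blast
    then have "proj (\<Phi> r) = \<one>\<^bsub>BS k l\<^esub>"
      using ker that R proj_\<Phi>[of r] by (auto simp: kernel_def)
    then show "finite (moved (\<Psi> r))"
      using that R proj_eq_one_iff[of "\<Phi> r"] moved_N[of "\<Phi> r"] by (auto simp: \<Psi>_def)
    show "card (moved (\<Psi> r)) \<le> M"
      unfolding M_def using SR(3) that by (intro member_le_sum) auto
  qed

  obtain d :: int where d: "d \<noteq> 0"
    "\<And>m::nat. t [^]\<^bsub>BS k l\<^esub> m \<otimes>\<^bsub>BS k l\<^esub> a [^]\<^bsub>BS k l\<^esub> d \<otimes>\<^bsub>BS k l\<^esub> inv\<^bsub>BS k l\<^esub> (t [^]\<^bsub>BS k l\<^esub> m) \<otimes>\<^bsub>BS k l\<^esub> a [^]\<^bsub>BS k l\<^esub> d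
      = a [^]\<^bsub>BS k l\<^esub> d \<otimes>\<^bsub>BS k l\<^esub> (t [^]\<^bsub>BS k l\<^esub> m \<otimes>\<^bsub>BS k l\<^esub> a [^]\<^bsub>BS k l\<^esub> d \<otimes>\<^bsub>BS k l\<^esub> inv\<^bsub>BS k l\<^esub> (t [^]\<^bsub>BS k l\<^esub> m))"
    using commuting_conjugates[OF assms] by blast
  \<comment> \<open>\<open>a\<close> need not belong to \<open>S\<close>, so a preimage in
    \<open>P\<close> takes the place of the letter.\<close>
  obtain A where A: "A \<in> carrier P" "rel_hom (BS k l) A = a"
  proof -
    have "a \<in> rel_hom (BS k l) ` carrier P" unfolding surj by simp
    then show ?thesis using that by (elim imageE) simp
  qed
  define Ad where "Ad = A [^]\<^bsub>P\<^esub> d"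
  have Ad: "Ad \<in> carrier P" "rel_hom (BS k l) Ad = a [^]\<^bsub>BS k l\<^esub> d"
    using A by (simp_all add: Ad_def rel.hom_int_pow)
  \<comment> \<open>The discrepancy between the chosen lift of a^d and the power itself. It lies in
    \<open>N\<close>, so it disturbs \<open>shear d\<close> over the finitely many fibres collected
    in \<open>T\<close> below.\<close>
  define \<nu> where "\<nu> = bs_a [^]\<^bsub>bs_free\<^esub> (- d) \<otimes>\<^bsub>bs_free\<^esub> \<Phi> Ad"
  have \<nu>: "\<nu> \<in> N"
  proof -
    have "proj \<nu> = \<one>\<^bsub>BS k l\<^esub>"
      using Ad proj_\<Phi>[OF Ad(1)] by (simp add: \<nu>_def proj.hom_int_pow G.int_pow_neg)
    then show ?thesis using Ad(1) proj_eq_one_iff[of \<nu>] by (simp add: \<nu>_def)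
  qed
  define B where "B = \<Psi> Ad"
  have B: "B \<in> fibred" using \<Psi>.hom_closed[OF Ad(1)] by (simp add: B_def)
  have B_eq: "B = shear d \<circ> \<psi> \<nu>"
  proof -
    have "\<Phi> Ad = bs_a [^]\<^bsub>bs_free\<^esub> d \<otimes>\<^bsub>bs_free\<^esub> \<nu>"
      using Ad(1) by (simp add: \<nu>_def F.int_pow_neg)
    moreover have "\<nu> \<in> carrier bs_free" using Ad(1) by (simp add: \<nu>_def)
    ultimately show ?thesis
      by (simp add: B_def \<Psi>_def \<psi>_a_pow del: \<psi>.hom_int_pow)
  qed
  define T where "T = moved (\<psi> \<nu>)"
  have T: "finite T" "\<And>i v. i \<notin> T \<Longrightarrow> B (i, v) = shear d (i, v)"
    unfolding T_def B_eq using moved_N[OF \<nu>] by (auto simp: moved_def)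

  obtain U where U: "U \<in> lists (rel_alphabet (BS k l) H S)" "rel_word_value (BS k l) H S U = Ad"
    using rel_word_value_surj[OF Ad(1)] .
  obtain V where V: "V \<in> lists (rel_alphabet (BS k l) H S)" "rel_word_value (BS k l) H S V = inv\<^bsub>P\<^esub> Ad"
    using rel_word_value_surj[OF P.inv_closed[OF Ad(1)]] .
  \<comment> \<open>This is the length of the word \<open>W\<close> below, with four powers of
    \<open>t\<close> and two copies each of \<open>U\<close> and \<open>V\<close>; it does not
    depend on \<open>m\<close>.\<close>
  define n where "n = 4 + 2 * length U + 2 * length V"
  obtain D where D: "rel_dehn (BS k l) H S R n = enat D" using dehn[of n] by auto
  define Q where "Q e \<longleftrightarrow> (\<forall>W \<in> lists (rel_alphabet (BS k l) H S).
        length W \<le> n \<and> rel_hom (BS k l) (rel_word_value (BS k l) H S W) = \<one>\<^bsub>BS k l\<^esub> \<longrightarrow>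
        (\<exists>j. enat j \<le> e \<and> conj_product P R j (rel_word_value (BS k l) H S W)))" for e
  \<comment> \<open>\<open>LEAST\<close> satisfies its predicate only if some value does. The value
    \<open>\<infinity>\<close> does, because every word representing 1 has finite area.\<close>
  have "Q \<infinity>"
    unfolding Q_def
  proof (intro ballI impI)
    fix W assume W: "W \<in> lists (rel_alphabet (BS k l) H S)"
      and 1: "length W \<le> n \<and> rel_hom (BS k l) (rel_word_value (BS k l) H S W) = \<one>\<^bsub>BS k l\<^esub>"
    then have "rel_word_value (BS k l) H S W \<in> normal_closure P R"
      using rel_word_value_closed[OF W] by (simp add: ker kernel_def)
    then show "\<exists>j. enat j \<le> \<infinity> \<and> conj_product P R j (rel_word_value (BS k l) H S W)"
      using P.conj_product_normal_closure[OF R] by (metis enat_ord_code(3))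
  qed
  then have "Q (LEAST e. Q e)" by (rule LeastI)
  moreover have "(LEAST e. Q e) = enat D" unfolding D[symmetric] rel_dehn_def Q_def ..
  ultimately have Q: "Q (enat D)" by simp

  \<comment> \<open>\<open>D\<close> relators move at most \<open>D * M\<close> fibres, while the
    commutator moves at least \<open>m - 2 * card T\<close>; this \<open>m\<close> makes the two
    incompatible.\<close>
  define m where "m = Suc (D * M + 2 * card T)"
  define \<tau> where "\<tau> = inc (t [^]\<^bsub>BS k l\<^esub> int m)"
  define \<tau>' where "\<tau>' = inc (t [^]\<^bsub>BS k l\<^esub> (- int m))"
  have th: "t [^]\<^bsub>BS k l\<^esub> i \<in> H" for i :: int unfolding H_eq by blast
  have tn: "t [^]\<^bsub>BS k l\<^esub> i \<noteq> \<one>\<^bsub>BS k l\<^esub>" if "i \<noteq> 0" for i :: int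
    using t_pow_inj[of i 0] that by auto
  have \<tau>: "\<tau> \<in> carrier P" "\<tau>' = inv\<^bsub>P\<^esub> \<tau>"
  proof -
    show "\<tau> \<in> carrier P" using th by (simp add: \<tau>_def)
    interpret inc: group_hom "(BS k l)\<lparr>carrier := H\<rparr>" P inc
      by (intro group_hom.intro group_hom_axioms.intro inc_hom group_H P.is_group)
    have "\<tau>' \<otimes>\<^bsub>P\<^esub> \<tau> = \<one>\<^bsub>P\<^esub>"
      using inc.hom_one unfolding \<tau>_def \<tau>'_def inc_mult[OF th th, symmetric]
      by (simp flip: G.int_pow_mult)
    then show "\<tau>' = inv\<^bsub>P\<^esub> \<tau>"
      using th by (intro P.inv_equality[symmetric]) (simp_all add: \<tau>_def \<tau>'_def)
  qed
  define X where "X = \<tau> \<otimes>\<^bsub>P\<^esub> Ad \<otimes>\<^bsub>P\<^esub> \<tau>'"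
  have X: "X \<in> carrier P" using \<tau> Ad by (simp add: X_def)
  \<comment> \<open>A word for the commutator of \<open>X\<close> and \<open>Ad\<close>, whose
    second half spells the two inverses. As \<open>m\<close> is positive, the powers of
    \<open>t\<close> are non-trivial and each is one letter.\<close>
  define W where "W = [Inr (t [^]\<^bsub>BS k l\<^esub> int m)] @ U @ [Inr (t [^]\<^bsub>BS k l\<^esub> (- int m))] @ U @
    [Inr (t [^]\<^bsub>BS k l\<^esub> int m)] @ V @ [Inr (t [^]\<^bsub>BS k l\<^esub> (- int m))] @ V"
  have letters: "Inr (t [^]\<^bsub>BS k l\<^esub> int m) \<in> rel_alphabet (BS k l) H S"
    "Inr (t [^]\<^bsub>BS k l\<^esub> (- int m)) \<in> rel_alphabet (BS k l) H S"
    using th tn by (auto simp: rel_alphabet_def m_def simp del: of_nat_Suc)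
  then have W: "W \<in> lists (rel_alphabet (BS k l) H S)" "length W \<le> n"
    using U V by (auto simp: W_def n_def)
  have val: "rel_word_value (BS k l) H S W = X \<otimes>\<^bsub>P\<^esub> Ad \<otimes>\<^bsub>P\<^esub> inv\<^bsub>P\<^esub> X \<otimes>\<^bsub>P\<^esub> inv\<^bsub>P\<^esub> Ad"
  proof -
    have "rel_word_value (BS k l) H S W =
        \<tau> \<otimes>\<^bsub>P\<^esub> (Ad \<otimes>\<^bsub>P\<^esub> (\<tau>' \<otimes>\<^bsub>P\<^esub> (Ad \<otimes>\<^bsub>P\<^esub> (\<tau> \<otimes>\<^bsub>P\<^esub> (inv\<^bsub>P\<^esub> Ad \<otimes>\<^bsub>P\<^esub> (\<tau>' \<otimes>\<^bsub>P\<^esub> inv\<^bsub>P\<^esub> Ad))))))"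
      using U V letters unfolding W_def
      by (simp add: rel_word_value_append rel_word_value_letter rel_letter_Inr \<tau>_def \<tau>'_def
          del: append_Cons in_lists_conv_set)
    then show ?thesis
      using \<tau> Ad by (simp add: X_def P.inv_mult_group P.m_assoc)
  qed
  have "rel_hom (BS k l) X = t [^]\<^bsub>BS k l\<^esub> m \<otimes>\<^bsub>BS k l\<^esub> a [^]\<^bsub>BS k l\<^esub> d \<otimes>\<^bsub>BS k l\<^esub> inv\<^bsub>BS k l\<^esub> (t [^]\<^bsub>BS k l\<^esub> m)"
    using \<tau> Ad th[of "int m"] by (simp add: X_def \<tau>_def rel_hom_inc int_pow_int)
  then have "rel_hom (BS k l) (X \<otimes>\<^bsub>P\<^esub> Ad) = rel_hom (BS k l) (Ad \<otimes>\<^bsub>P\<^esub> X)"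
    using d(2)[of m] X Ad by simp
  then have "rel_hom (BS k l) (rel_word_value (BS k l) H S W) = \<one>\<^bsub>BS k l\<^esub>"
    using X Ad unfolding val by (simp add: G.m_assoc)
  then obtain j where j: "j \<le> D" "conj_product P R j (rel_word_value (BS k l) H S W)"
    using Q W unfolding Q_def by auto
  have fin: "finite (moved (\<Psi> (rel_word_value (BS k l) H S W)))"
    and card: "card (moved (\<Psi> (rel_word_value (BS k l) H S W))) \<le> j * M"
    using card_moved_conj_product[OF P.is_group \<Psi>_hom R M j(2)] by auto
  have "\<Psi> X = shift (int m) \<otimes>\<^bsub>fibred_group\<^esub> B \<otimes>\<^bsub>fibred_group\<^esub> shift (- int m)"
  proof -
    have "\<Psi> \<tau> = shift (int m)" "\<Psi> \<tau>' = shift (- int m)"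
      using th by (simp_all add: \<Psi>_def \<tau>_def \<tau>'_def \<Phi>_lift(3) \<eta>_def ex \<psi>_t_pow del: \<psi>.hom_int_pow)
    then show ?thesis using \<tau> Ad unfolding X_def B_def
      by (metis P.inv_closed P.m_closed \<Psi>.hom_mult)
  qed
  moreover have "\<Psi> (rel_word_value (BS k l) H S W) =
      \<Psi> X \<otimes>\<^bsub>fibred_group\<^esub> B \<otimes>\<^bsub>fibred_group\<^esub> inv\<^bsub>fibred_group\<^esub> \<Psi> X \<otimes>\<^bsub>fibred_group\<^esub> inv\<^bsub>fibred_group\<^esub> B"
    using X Ad(1) unfolding val B_def by (simp only: \<Psi>.hom_mult \<Psi>.hom_inv P.m_closed P.inv_closed)
  ultimately have "m \<le> card (moved (\<Psi> (rel_word_value (BS k l) H S W))) + 2 * card T"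
    using moved_commutator[OF B T d(1), of m] fin by simp
  also have "\<dots> \<le> D * M + 2 * card T"
    using le_trans[OF card mult_le_mono1[OF j(1), of M]] by simp
  finally show False by (simp add: m_def)
qed

end

section \<open>Britton's lemma\<close>

text \<open>\<open>Node r e x\<close> stands for \<open>a\<^sup>r t\<^sup>\<plusminus>\<^sup>1 x\<close>, with exponent \<open>1\<close> iff \<open>e\<close>, and \<open>Base c\<close> for \<open>a\<^sup>c\<close>.\<close>

datatype nf = Base int | Node int bool nf

text \<open>Left multiplication by t or its inverse. The only reduction is the cancellation of a
  leading opposite letter with remainder 0 in front of it.\<close>

fun prepend :: "bool \<Rightarrow> nf \<Rightarrow> nf" where
  "prepend e (Base c) = Node 0 e (Base c)"
| "prepend e (Node r e' x) = (if r = 0 \<and> e' \<noteq> e then x else Node 0 e (Node r e' x))"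

definition no_cancel :: "bool \<Rightarrow> nf \<Rightarrow> bool" where
  "no_cancel e x \<longleftrightarrow> (\<forall>y. x \<noteq> Node 0 (\<not> e) y)"

lemma prepend_eq: "no_cancel e x \<Longrightarrow> prepend e x = Node 0 e x"
  by (cases x) (auto simp: no_cancel_def)

lemma perm_group_nat_pow: "f [^]\<^bsub>perm_group\<^esub> (n::nat) = f ^^ n"
  by (induction n) (simp_all add: nat_pow_def perm_group_def funpow_swap1 fun_eq_iff)

text \<open>Words in syllable form: a power of \<open>t\<close> is one syllable whatever its
  exponent, in accordance with relative word length.\<close>

fun syl :: "('g, 'm) monoid_scheme \<Rightarrow> 'g \<Rightarrow> 'g \<Rightarrow> (int \<times> int) list \<Rightarrow> int \<Rightarrow> 'g" where
  "syl K x y [] \<beta> = x [^]\<^bsub>K\<^esub> \<beta>"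
| "syl K x y ((\<alpha>, m) # xs) \<beta> = x [^]\<^bsub>K\<^esub> \<alpha> \<otimes>\<^bsub>K\<^esub> (y [^]\<^bsub>K\<^esub> m \<otimes>\<^bsub>K\<^esub> syl K x y xs \<beta>)"

lemma (in group) syl_closed [simp]:
  "x \<in> carrier G \<Longrightarrow> y \<in> carrier G \<Longrightarrow> syl G x y xs \<beta> \<in> carrier G"
  by (induction xs) auto

lemma (in group_hom) hom_syl:
  "x \<in> carrier G \<Longrightarrow> y \<in> carrier G \<Longrightarrow> h (syl G x y xs \<beta>) = syl H (h x) (h y) xs \<beta>"
  by (induction xs) (auto simp: hom_int_pow)

section \<open>Action of the free group on normal forms\<close>

context baumslag_solitar
begin

text \<open>For \<open>s = t\<close> if \<open>e\<close> and \<open>s = t\<^sup>-\<^sup>1\<close> otherwise, \<open>a\<^sup>c s = s a\<^sup>c\<^sup>'\<close> with \<open>c = md e\<close> and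
  \<open>c' = md (\<not> e)\<close>.\<close>

definition md :: "bool \<Rightarrow> int" where "md e = (if e then l else k)"

lemma md_nonzero [simp]: "md e \<noteq> 0"
  using k l by (simp add: md_def)

text \<open>Left multiplication by a^n. The remainder modulo \<open>md e\<close> stays in front of
  the letter; the multiple of \<open>md e\<close> passes it and becomes a multiple of
  \<open>md (\<not> e)\<close>.\<close>

fun act :: "int \<Rightarrow> nf \<Rightarrow> nf" where
  "act n (Base c) = Base (n + c)"
| "act n (Node r e x) = Node ((n + r) mod md e) e (act (md (\<not> e) * ((n + r) div md e)) x)"

text \<open>Normal forms of an HNN extension. Being fixed by \<open>mod\<close> selects coset
  representatives uniformly for either sign of the modulus.\<close>

fun valid :: "nf \<Rightarrow> bool" where
  "valid (Base c) = True"
| "valid (Node r e x) \<longleftrightarrow> r mod md e = r \<and> valid x \<and> no_cancel e x"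

lemma act_add: "act (m + n) x = act m (act n x)"
proof (induction x arbitrary: m n)
  case (Node r e x)
  have "(m + n + r) div md e = (m + (n + r) mod md e) div md e + (n + r) div md e"
  proof -
    have "m + n + r = m + (n + r) mod md e + (n + r) div md e * md e" by simp
    then show ?thesis by (metis div_mult_self3 md_nonzero add.commute)
  qed
  moreover have "(m + (n + r) mod md e) mod md e = (m + n + r) mod md e"
    by (simp add: mod_add_right_eq add.assoc)
  ultimately show ?case by (simp flip: Node add: distrib_left)
qed simp

lemma act_0: "valid x \<Longrightarrow> act 0 x = x"
proof (induction x)
  case (Node r e x)
  have "r div md e = 0" using Node.prems div_mult_mod_eq[of r "md e"] by simp
  then show ?case using Node by simp
qed simp

text \<open>What passes the letter given by \<open>e\<close> is a multiple of
  \<open>md (\<not> e)\<close>, which leaves the remainder in front of a following opposite letter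
  unchanged. A non-zero remainder thus stays non-zero.\<close>

lemma no_cancel_act:
  assumes "valid x" "no_cancel e x" shows "no_cancel e (act (md (\<not> e) * c) x)"
proof (cases x)
  case (Node r e' y)
  show ?thesis
  proof (cases "e' = e")
    case False
    then have e': "e' = (\<not> e)" by auto
    then have "r \<noteq> 0" "r mod md (\<not> e) = r" using assms Node by (auto simp: no_cancel_def)
    then have "(md (\<not> e) * c + r) mod md (\<not> e) \<noteq> 0" by simp
    then show ?thesis using Node e' by (simp add: no_cancel_def)
  qed (use Node in \<open>auto simp: no_cancel_def\<close>)
qed (simp add: no_cancel_def)

lemma valid_act: "valid x \<Longrightarrow> valid (act n x)"
  by (induction x arbitrary: n) (auto intro: no_cancel_act)

lemma valid_prepend: "valid x \<Longrightarrow> valid (prepend e x)"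
  by (cases x) (auto simp: no_cancel_def)

lemma prepend_prepend:
  assumes "valid x" shows "prepend (\<not> e) (prepend e x) = x"
proof (cases "no_cancel e x")
  case True
  then show ?thesis by (simp add: prepend_eq)
next
  case False
  then obtain y where "x = Node 0 (\<not> e) y" by (auto simp: no_cancel_def)
  then show ?thesis using assms by (simp add: prepend_eq)
qed

text \<open>This makes the relator act as the identity: for \<open>c = 1\<close> and true
  \<open>e\<close> it is the defining relation, read on normal forms.\<close>

lemma prepend_act_prepend:
  assumes "valid x"
  shows "prepend e (act (md (\<not> e) * c) (prepend (\<not> e) x)) = act (md e * c) x"
proof (cases "no_cancel (\<not> e) x")
  case True
  then show ?thesis by (simp add: prepend_eq)
next
  case False
  then obtain y where x: "x = Node 0 e y" by (auto simp: no_cancel_def)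
  then have "no_cancel e (act (md (\<not> e) * c) y)" using assms by (intro no_cancel_act) auto
  then show ?thesis using x by (simp add: prepend_eq)
qed

text \<open>\<open>prepend\<close> is invertible on valid terms; invalid ones are fixed in order to
  obtain a permutation of the whole type.\<close>

definition turn :: "bool \<Rightarrow> nf \<Rightarrow> nf" where
  "turn e x = (if valid x then prepend e x else x)"

definition rot :: "int \<Rightarrow> nf \<Rightarrow> nf" where
  "rot n x = (if valid x then act n x else x)"

lemma bij_turn: "bij (turn e)"
  by (rule o_bij[of "turn (\<not> e)"])
    (use prepend_prepend[of _ e] prepend_prepend[of _ "\<not> e"] valid_prepend in
      \<open>auto simp: turn_def fun_eq_iff\<close>)

lemma inv_turn: "inv\<^bsub>perm_group\<^esub> turn e = turn (\<not> e)"
  by (rule group.inv_equality[OF group_perm_group])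
    (use prepend_prepend[of _ e] valid_prepend bij_turn in \<open>auto simp: turn_def fun_eq_iff\<close>)

lemma rot_add: "rot (m + n) = rot m \<circ> rot n"
  by (auto simp: rot_def fun_eq_iff act_add valid_act)

lemma bij_rot: "bij (rot n)"
proof -
  have "rot (- n) \<circ> rot n = id" "rot n \<circ> rot (- n) = id"
    unfolding rot_add[symmetric] by (auto simp: rot_def act_0)
  then show ?thesis by (rule o_bij)
qed

definition \<theta> where "\<theta> = free_group_lift perm_group (case_bs_gen (rot 1) (turn True))"

lemma \<theta>_hom: "\<theta> \<in> hom bs_free perm_group"
  and \<theta>_a: "\<theta> bs_a = rot 1"
  and \<theta>_t: "\<theta> bs_t = turn True"
proof -
  have "case_bs_gen (rot 1) (turn True) \<in> UNIV \<rightarrow> carrier perm_group"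
    by (auto split: bs_gen.split simp: bij_rot bij_turn)
  note free_group_lift[OF group_perm_group this, folded \<theta>_def]
  then show "\<theta> \<in> hom bs_free perm_group" "\<theta> bs_a = rot 1" "\<theta> bs_t = turn True"
    by simp_all
qed

sublocale \<theta>: group_hom bs_free perm_group \<theta>
  by (intro group_hom.intro group_hom_axioms.intro \<theta>_hom group_perm_group F.is_group)

lemma \<theta>_a_pow: "\<theta> (bs_a [^]\<^bsub>bs_free\<^esub> (n::int)) = rot n"
  using \<theta>.H.one_parameter_int_pow[of rot n]
  by (simp add: \<theta>.hom_int_pow \<theta>_a rot_add bij_rot)

text \<open>The power becomes an iterate of one \<open>turn\<close>, in the direction given by the
  sign of \<open>m\<close>, so that it can be followed letter by letter.\<close>

lemma \<theta>_t_pow: "\<theta> (bs_t [^]\<^bsub>bs_free\<^esub> (m::int)) = turn (m > 0) ^^ nat \<bar>m\<bar>"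
proof (cases "m > 0")
  case True
  then show ?thesis
    using perm_group_nat_pow[of "turn True" "nat m"]
    by (simp add: \<theta>.hom_int_pow \<theta>_t)
next
  case False
  then have "turn True [^]\<^bsub>perm_group\<^esub> m = inv\<^bsub>perm_group\<^esub> (turn True [^]\<^bsub>perm_group\<^esub> (- m))"
    using \<theta>.H.int_pow_neg[of "turn True" "- m"] bij_turn by simp
  also have "\<dots> = turn False [^]\<^bsub>perm_group\<^esub> (- m)"
    using \<theta>.H.int_pow_inv[of "turn True" "- m"] bij_turn by (simp add: inv_turn)
  also have "\<dots> = turn False ^^ nat (- m)"
    using perm_group_nat_pow[of "turn False" "nat (- m)"] False by simp
  finally show ?thesis using False by (simp add: \<theta>.hom_int_pow \<theta>_t)
qed

lemma \<theta>_relator: "\<theta> (bs_relator k l) = id"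
proof -
  have "turn True \<circ> rot k \<circ> turn False = rot l"
    using prepend_act_prepend[of _ True 1]
    by (auto simp: turn_def rot_def fun_eq_iff md_def valid_prepend valid_act)
  moreover have "inv\<^bsub>bs_free\<^esub> (bs_a [^]\<^bsub>bs_free\<^esub> l) = bs_a [^]\<^bsub>bs_free\<^esub> (- l)"
    by (simp add: F.int_pow_neg)
  ultimately have "\<theta> (bs_relator k l) = rot l \<circ> rot (- l)"
    unfolding bs_relator_def Let_def
    by (simp del: \<theta>.hom_int_pow add: \<theta>_a_pow \<theta>_t inv_turn)
  also have "\<dots> = id" unfolding rot_add[symmetric] by (auto simp: rot_def act_0)
  finally show ?thesis .
qed

lemma \<theta>_N: "w \<in> N \<Longrightarrow> \<theta> w = id"
  using lift_normal_closure[OF group_perm_group \<theta>_hom \<theta>.H.one_is_normal] \<theta>_relator by simp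

section \<open>Reduced words and Britton's lemma\<close>

text \<open>A site can be pinched if the signs around it differ and \<open>md (m \<le> 0)\<close>
  divides its exponent: \<open>k\<close> after a positive power of \<open>t\<close>,
  \<open>l\<close> after a negative one. The first exponent of \<open>a\<close> has no power of
  \<open>t\<close> to its left and is unconstrained.\<close>

fun reduced :: "(int \<times> int) list \<Rightarrow> bool" where
  "reduced [] \<longleftrightarrow> True"
| "reduced [(\<alpha>, m)] \<longleftrightarrow> m \<noteq> 0"
| "reduced ((\<alpha>, m) # (\<alpha>', m') # xs) \<longleftrightarrow>
     m \<noteq> 0 \<and> \<not> (m * m' < 0 \<and> md (m \<le> 0) dvd \<alpha>') \<and> reduced ((\<alpha>', m') # xs)"

text \<open>After the first step the term begins with the very letter that is being prepended, so
  nothing cancels later.\<close>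

lemma turn_pow:
  assumes "valid x" "no_cancel e x" "n > 0"
  shows "\<exists>y. (turn e ^^ n) x = Node 0 e y \<and> valid ((turn e ^^ n) x)"
  using assms(3)
proof (induction n rule: nat_induct_non_zero)
  case 1
  then show ?case using assms by (simp add: turn_def prepend_eq)
next
  case (Suc n)
  then obtain y where y: "(turn e ^^ n) x = Node 0 e y" "valid (Node 0 e y)" by auto
  then have "no_cancel e (Node 0 e y)" by (simp add: no_cancel_def)
  then have "turn e (Node 0 e y) = Node 0 e (Node 0 e y)" using y(2)
    by (simp add: turn_def)
  then show ?case using y \<open>no_cancel e (Node 0 e y)\<close> by simp
qed

text \<open>The leading power of \<open>a\<close> is left out, so that the first remainder of the
  result is 0 and the induction can track how the next exponent to the left changes it.\<close>

lemma reduced_action: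
  assumes "reduced ((\<alpha>, m) # xs)"
  shows "\<exists>y. \<theta> (bs_t [^]\<^bsub>bs_free\<^esub> m \<otimes>\<^bsub>bs_free\<^esub> syl bs_free bs_a bs_t xs \<beta>) (Base 0) = Node 0 (m > 0) y \<and>
    valid (Node 0 (m > 0) y)"
  using assms
proof (induction xs arbitrary: \<alpha> m)
  case Nil
  then show ?case
    using turn_pow[of "Base \<beta>" "m > 0" "nat \<bar>m\<bar>"]
    by (auto simp: \<theta>_t_pow \<theta>_a_pow rot_def no_cancel_def simp del: \<theta>.hom_int_pow)
next
  case (Cons p xs)
  obtain \<alpha>' m' where p: "p = (\<alpha>', m')" by fastforce
  have red: "m \<noteq> 0" "m' \<noteq> 0" "\<not> (m * m' < 0 \<and> md (m \<le> 0) dvd \<alpha>')" "reduced ((\<alpha>', m') # xs)"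
    using Cons.prems p by (auto elim: reduced.elims)
  obtain y where y: "\<theta> (bs_t [^]\<^bsub>bs_free\<^esub> m' \<otimes>\<^bsub>bs_free\<^esub> syl bs_free bs_a bs_t xs \<beta>) (Base 0) = Node 0 (m' > 0) y"
    "valid (Node 0 (m' > 0) y)"
    using Cons.IH[OF red(4)] by blast
  \<comment> \<open>The normal form once \<open>\<alpha>'\<close> has acted. Its first remainder is
    that of \<open>\<alpha>'\<close>, which is non-zero at a change of sign because the word is
    reduced.\<close>
  define z where "z = act \<alpha>' (Node 0 (m' > 0) y)"
  have z: "valid z" unfolding z_def by (rule valid_act[OF y(2)])
  have "no_cancel (m > 0) z"
  proof (cases "(m' > 0) = (m > 0)")
    case True
    then show ?thesis by (simp add: z_def no_cancel_def)
  next
    case False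
    then have "m * m' < 0" using red(1,2) by (auto simp: mult_less_0_iff)
    moreover have "(m \<le> 0) = (m' > 0)" using False by auto
    ultimately have "\<not> md (m' > 0) dvd \<alpha>'" using red(3) by simp
    then show ?thesis by (auto simp: z_def no_cancel_def dvd_eq_mod_eq_0)
  qed
  moreover have "\<theta> (syl bs_free bs_a bs_t (p # xs) \<beta>) (Base 0) = z"
    using y by (simp add: p z_def \<theta>_a_pow rot_def del: \<theta>.hom_int_pow act.simps)
  ultimately show ?case
    using turn_pow[OF z, of "m > 0" "nat \<bar>m\<bar>"] red(1)
    by (auto simp: \<theta>_t_pow simp del: \<theta>.hom_int_pow syl.simps)
qed

text \<open>Words trivial in the group fix \<open>Base 0\<close>, whereas a reduced word that
  contains a power of \<open>t\<close> maps it to a \<open>Node\<close>.\<close>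

lemma britton:
  assumes "syl (BS k l) a t xs \<beta> = \<one>\<^bsub>BS k l\<^esub>" "reduced xs"
  shows "xs = [] \<and> \<beta> = 0"
proof -
  let ?w = "syl bs_free bs_a bs_t xs \<beta>"
  have "proj ?w = \<one>\<^bsub>BS k l\<^esub>" using assms(1) by (simp add: proj.hom_syl)
  then have id: "\<theta> ?w = id" by (intro \<theta>_N) (simp add: proj_eq_one_iff)
  show ?thesis
  proof (cases xs)
    case Nil
    then have "rot \<beta> (Base 0) = Base 0"
      using id by (simp add: \<theta>_a_pow del: \<theta>.hom_int_pow)
    then show ?thesis using Nil by (simp add: rot_def)
  next
    case (Cons p ys)
    obtain \<alpha> m where p: "p = (\<alpha>, m)" by fastforce
    obtain y where y: "\<theta> (bs_t [^]\<^bsub>bs_free\<^esub> m \<otimes>\<^bsub>bs_free\<^esub> syl bs_free bs_a bs_t ys \<beta>) (Base 0) = Node 0 (m > 0) y"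
      "valid (Node 0 (m > 0) y)"
      using reduced_action[of \<alpha> m ys \<beta>] assms(2) Cons p by blast
    have "\<theta> ?w (Base 0) = act \<alpha> (Node 0 (m > 0) y)"
      using y by (simp add: Cons p \<theta>_a_pow rot_def del: \<theta>.hom_int_pow act.simps)
    then show ?thesis using id by simp
  qed
qed

end

section \<open>Pinching\<close>

text \<open>Exponents of \<open>t\<close> are ignored, as a power of \<open>t\<close> has relative
  length 1 and its exponent cannot be bounded.\<close>

fun weight :: "(int \<times> int) list \<Rightarrow> int \<Rightarrow> nat" where
  "weight [] \<beta> = nat \<bar>\<beta>\<bar>"
| "weight ((\<alpha>, m) # xs) \<beta> = nat \<bar>\<alpha>\<bar> + weight xs \<beta>"

lemma weight_append: "weight (xs @ ys) \<beta> = weight xs 0 + weight ys \<beta>"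
  by (induction xs \<beta> rule: weight.induct) auto

context group
begin

lemma syl_append:
  assumes "x \<in> carrier G" "y \<in> carrier G"
  shows "syl G x y (us @ vs) \<beta> = syl G x y us 0 \<otimes> syl G x y vs \<beta>"
  using assms by (induction us "0::int" rule: weight.induct) (auto simp: m_assoc)

lemma syl_absorb:
  assumes "x \<in> carrier G" "y \<in> carrier G"
  obtains ys \<gamma> where "syl G x y ys \<gamma> = x [^] \<alpha> \<otimes> syl G x y xs \<beta>" "length ys = length xs"
    "weight ys \<gamma> \<le> nat \<bar>\<alpha>\<bar> + weight xs \<beta>"
proof (cases xs)
  case Nil
  then show ?thesis using assms that[of "[]" "\<alpha> + \<beta>"] by (simp add: int_pow_mult)
next
  case (Cons p zs)
  obtain \<alpha>' m where "p = (\<alpha>', m)" by fastforce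
  then show ?thesis using assms Cons that[of "(\<alpha> + \<alpha>', m) # zs" \<beta>]
    by (simp add: int_pow_mult m_assoc)
qed

text \<open>The exponents of \<open>a\<close> on both sides of a trivial power of \<open>t\<close>
  are added; by the triangle inequality the weight does not grow.\<close>

lemma syl_drop_zero:
  assumes "x \<in> carrier G" "y \<in> carrier G" "(\<alpha>, 0) \<in> set xs"
  obtains ys \<gamma> where "syl G x y ys \<gamma> = syl G x y xs \<beta>" "length ys < length xs"
    "weight ys \<gamma> \<le> weight xs \<beta>"
proof -
  obtain us vs where xs: "xs = us @ (\<alpha>, 0) # vs" using assms(3) by (meson split_list)
  obtain ys \<gamma> where "syl G x y ys \<gamma> = x [^] \<alpha> \<otimes> syl G x y vs \<beta>" "length ys = length vs"
    "weight ys \<gamma> \<le> nat \<bar>\<alpha>\<bar> + weight vs \<beta>"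
    using syl_absorb[OF assms(1,2)] by metis
  then show ?thesis using assms(1,2) that[of "us @ ys" \<gamma>]
    by (simp add: xs syl_append weight_append)
qed

text \<open>One factor \<open>y [^] s\<close> is split off the power on the left of the site and its
  inverse off the one on the right. Conjugation is an endomorphism, so the middle is the
  \<open>q\<close>-th power of the left side of \<open>near\<close>, and each of its factors costs
  one relator.\<close>

lemma near_pinch:
  assumes xy: "x \<in> carrier G" "y \<in> carrier G" and R: "R \<subseteq> carrier G"
    and near: "near G R 1 (y [^] s \<otimes> x [^] p \<otimes> y [^] (- s)) (x [^] (p' :: int))"
  shows "near G R (nat \<bar>q\<bar>)
    (syl G x y (us @ (\<alpha>, m) # (p * q, m') # vs) \<beta>)
    (syl G x y (us @ (\<alpha>, m - s) # (p' * q, m' + s) # vs) (\<beta> :: int))"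
proof -
  let ?c = "\<lambda>z. y [^] s \<otimes> z \<otimes> y [^] (- s)"
  interpret c: group_hom G G ?c
    by unfold_locales (use xy in \<open>auto simp: hom_def m_assoc int_pow_neg\<close>)
  have c: "?c (x [^] (p * q)) = ?c (x [^] p) [^] q"
    using c.hom_int_pow[of "x [^] p" q] xy by (simp add: int_pow_pow)
  let ?g = "syl G x y vs \<beta>"
  have "near G R (nat \<bar>q\<bar>) (?c (x [^] (p * q))) (x [^] (p' * q))"
    using near_int_pow[OF R near, of q] xy unfolding c by (simp add: int_pow_pow)
  then have "near G R (nat \<bar>q\<bar>)
     (syl G x y us 0 \<otimes> (x [^] \<alpha> \<otimes> (y [^] (m - s) \<otimes> (?c (x [^] (p * q)) \<otimes> (y [^] (m' + s) \<otimes> ?g)))))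
     (syl G x y us 0 \<otimes> (x [^] \<alpha> \<otimes> (y [^] (m - s) \<otimes> (x [^] (p' * q) \<otimes> (y [^] (m' + s) \<otimes> ?g)))))"
    using xy by (intro near_lmult[OF R] near_rmult[OF R]) auto
  moreover have "y [^] (m - s) \<otimes> (?c (x [^] (p * q)) \<otimes> (y [^] (m' + s) \<otimes> ?g)) =
      y [^] m \<otimes> (x [^] (p * q) \<otimes> (y [^] m' \<otimes> ?g))"
  proof -
    have "y [^] (m - s) \<otimes> y [^] s = y [^] m" "y [^] (- s) \<otimes> y [^] (m' + s) = y [^] m'"
      using xy by (simp_all flip: int_pow_mult)
    moreover have "y [^] (m - s) \<otimes> (?c (x [^] (p * q)) \<otimes> (y [^] (m' + s) \<otimes> ?g)) =
      (y [^] (m - s) \<otimes> y [^] s) \<otimes> (x [^] (p * q) \<otimes> ((y [^] (- s) \<otimes> y [^] (m' + s)) \<otimes> ?g))"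
      using xy by (simp add: m_assoc)
    ultimately show ?thesis by simp
  qed
  ultimately show ?thesis using xy by (simp add: syl_append)
qed

lemma conj_product_near:
  assumes "R \<subseteq> carrier G" "near G R c g h" "conj_product G R j h"
  shows "conj_product G R (c + j) g"
  using conj_product_mult[OF assms(1), of c "g \<otimes> inv h" j h] assms(2,3)
  by (simp add: near_def m_assoc)

end

lemma (in group_hom) hom_conj_product:
  assumes "R \<subseteq> carrier G" "\<And>r. r \<in> R \<Longrightarrow> h r = \<one>\<^bsub>H\<^esub>" "conj_product G R j w"
  shows "h w = \<one>\<^bsub>H\<^esub>"
  using assms(3)
proof (induction j arbitrary: w)
  case (Suc j)
  then obtain w' f r where *: "conj_product G R j w'" "f \<in> carrier G" "r \<in> R \<union> m_inv G ` R"
    "w = w' \<otimes> (inv f \<otimes> r \<otimes> f)" unfolding G.conj_product_Suc[OF assms(1)] by blast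
  have "r \<in> carrier G" "h r = \<one>\<^bsub>H\<^esub>" using *(3) assms(1,2) by (auto simp: subset_iff)
  then show ?case
    using *(2) Suc.IH[OF *(1)] G.conj_product_closed[OF assms(1) *(1)] unfolding *(4) by simp
qed (simp add: G.conj_product_0)

lemma (in group_hom) hom_near:
  assumes "R \<subseteq> carrier G" "\<And>r. r \<in> R \<Longrightarrow> h r = \<one>\<^bsub>H\<^esub>" "near G R c v w"
  shows "h v = h w"
proof -
  have vw: "v \<in> carrier G" "w \<in> carrier G" using assms(3) by (auto simp: near_def)
  have "h (v \<otimes> inv w) = \<one>\<^bsub>H\<^esub>"
    using assms(3) by (intro hom_conj_product[OF assms(1,2)]) (auto simp: near_def)
  then have "h v \<otimes>\<^bsub>H\<^esub> inv\<^bsub>H\<^esub> h w = \<one>\<^bsub>H\<^esub>" using vw by simp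
  then show ?thesis using vw by (simp add: H.inv_solve_right')
qed

text \<open>A non-unit base other than 0 has absolute value at least 2, so its powers outgrow their
  exponents.\<close>

lemma multiplicity_le_abs:
  fixes p x :: int
  assumes "\<not> is_unit p" shows "multiplicity p x \<le> nat \<bar>x\<bar>"
\<comment> \<open>In the degenerate cases the multiplicity is 0 by convention.\<close>
proof (cases "x = 0 \<or> p = 0")
  case False
  then have p: "\<bar>p\<bar> \<ge> 2" using assms by (auto simp: zdvd1_eq)
  let ?n = "multiplicity p x"
  have "int ?n < 2 ^ ?n" by (metis of_nat_less_two_power)
  also have "\<dots> \<le> \<bar>p\<bar> ^ ?n" using p by (intro power_mono) auto
  also have "\<dots> \<le> \<bar>x\<bar>"
    using multiplicity_dvd[of p x] False dvd_imp_le_int[of x "p ^ ?n"] by (simp add: power_abs)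
  finally show ?thesis by simp
qed auto

section \<open>A potential that decreases under pinching\<close>

context baumslag_solitar
begin

text \<open>The coprime parts of \<open>l\<close> and \<open>k\<close>. They need not be prime, but
  being coprime they let a pinch change the multiplicity in a controlled way.\<close>

definition root :: "bool \<Rightarrow> int" where "root e = md e div gcd k l"

lemma md_root: "md e = gcd k l * root e"
  by (simp add: root_def md_def)

lemma coprime_root: "coprime (root (\<not> e)) (root e)"
  using div_gcd_coprime[of k l] k by (cases e) (auto simp: root_def md_def coprime_commute)

text \<open>Each site between two powers of \<open>t\<close> contributes the number of times it can be pinched as long
  as the exponents of \<open>t\<close> around it keep their signs.\<close>

fun pot :: "(int \<times> int) list \<Rightarrow> nat" where
  "pot ((\<alpha>, m) # (\<alpha>', m') # xs) = multiplicity (root (m \<le> 0)) \<alpha>' + pot ((\<alpha>', m') # xs)"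
| "pot _ = 0"

lemma not_reduced_split:
  assumes "\<not> reduced xs" "\<And>\<alpha>. (\<alpha>, 0) \<notin> set xs"
  obtains us \<alpha> m \<alpha>' m' vs where "xs = us @ (\<alpha>, m) # (\<alpha>', m') # vs" "m * m' < 0" "md (m \<le> 0) dvd \<alpha>'"
proof -
  have "\<exists>us \<alpha> m \<alpha>' m' vs. xs = us @ (\<alpha>, m) # (\<alpha>', m') # vs \<and> m * m' < 0 \<and> md (m \<le> 0) dvd \<alpha>'"
    using assms
  proof (induction xs rule: reduced.induct)
    case (3 \<alpha> m \<alpha>' m' xs)
    show ?case
    proof (cases "m * m' < 0 \<and> md (m \<le> 0) dvd \<alpha>'")
      case True
      then show ?thesis by blast
    next
      case False
      moreover have "m \<noteq> 0" using "3.prems"(2)[of \<alpha>] by auto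
      ultimately have "\<not> reduced ((\<alpha>', m') # xs)" using "3.prems"(1) by simp
      then obtain us \<gamma> n \<gamma>' n' vs where
        "(\<alpha>', m') # xs = us @ (\<gamma>, n) # (\<gamma>', n') # vs" "n * n' < 0" "md (n \<le> 0) dvd \<gamma>'"
        using "3.IH" "3.prems"(2) by (metis list.set_intros(2))
      then show ?thesis by (metis append_Cons)
    qed
  qed auto
  then show ?thesis using that by blast
qed

lemma pot_append:
  "pot (us @ (\<alpha>, m) # xs) = pot (us @ [(\<alpha>, m)]) + pot ((\<alpha>, m) # xs)"
proof (induction us rule: pot.induct)
  case (1 \<gamma> n \<gamma>' n' us)
  then show ?case by simp
next
  case ("2_2" p)
  then show ?case by (cases p) simp
qed simp

text \<open>The sign of an exponent of \<open>t\<close> is read only at the site to its right, and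
  the last syllable has none.\<close>

lemma pot_last: "pot (us @ [(\<alpha>, m)]) = pot (us @ [(\<alpha>, m')])"
proof (induction us rule: pot.induct)
  case ("2_2" p)
  then show ?case by (cases p) simp
qed simp_all

text \<open>Pinching replaces the factor \<open>root (m \<le> 0)\<close> of the middle exponent by
  the coprime \<open>root (m > 0)\<close>, so the multiplicity counted there drops by one. At the
  other sites the signs and the exponents of \<open>a\<close> are as before.\<close>

lemma pot_pinch:
  assumes "\<not> is_unit (root (m \<le> 0))" "q \<noteq> 0" "m > 0 \<longleftrightarrow> n > 0" "m' > 0 \<longleftrightarrow> n' > 0"
  shows "pot (us @ (\<alpha>, n) # (md (m > 0) * q, n') # vs) < pot (us @ (\<alpha>, m) # (md (m \<le> 0) * q, m') # vs)"
proof -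
  let ?p = "root (m \<le> 0)" and ?p' = "root (m > 0)" and ?d = "gcd k l"
  have p0: "?p \<noteq> 0" using md_root[of "m \<le> 0"] md_nonzero[of "m \<le> 0"] by auto
  have cop: "coprime (?p ^ i) ?p'" for i
    using coprime_root[of "m > 0"] by (simp add: not_less coprime_commute)
  have "multiplicity ?p (?p' * (?d * q)) = multiplicity ?p (?d * q)"
    using cop by (simp add: multiplicity_def coprime_dvd_mult_right_iff)
  moreover have "multiplicity ?p (?p * (?d * q)) = Suc (multiplicity ?p (?d * q))"
    using assms(1,2) p0 k by (intro multiplicity_times_same) auto
  ultimately have *: "multiplicity ?p (md (m > 0) * q) < multiplicity ?p (md (m \<le> 0) * q)"
    by (simp add: md_root ac_simps)
  have sgn: "(n \<le> 0) = (m \<le> 0)" "(n' \<le> 0) = (m' \<le> 0)" using assms(3,4) by auto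
  have "pot ((md (m > 0) * q, n') # vs) = pot ((md (m \<le> 0) * q, m') # vs)"
    using sgn by (cases vs) auto
  then have "pot ((\<alpha>, n) # (md (m > 0) * q, n') # vs) < pot ((\<alpha>, m) # (md (m \<le> 0) * q, m') # vs)"
    using * sgn(1) by simp
  then show ?thesis
    using pot_append[of us \<alpha> n "(md (m > 0) * q, n') # vs"]
      pot_append[of us \<alpha> m "(md (m \<le> 0) * q, m') # vs"] pot_last[of us \<alpha> m n]
    by linarith
qed

lemma pot_le_weight:
  assumes "\<And>e. \<not> is_unit (root e)"
  shows "pot xs \<le> weight xs \<beta>"
proof -
  \<comment> \<open>The first exponent of \<open>a\<close> is not a site, so the weight of the tail
    suffices; this form goes through the induction.\<close>
  have "pot ((\<alpha>, m) # xs) \<le> weight xs \<beta>" for \<alpha> m xs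
  proof (induction xs arbitrary: \<alpha> m)
    case (Cons p xs)
    obtain \<alpha>' m' where "p = (\<alpha>', m')" by fastforce
    then show ?case
      using Cons[of \<alpha>' m'] multiplicity_le_abs[OF assms[of "m \<le> 0"], of \<alpha>'] by simp
  qed simp
  note * = this
  show ?thesis
  proof (cases xs)
    case (Cons p zs)
    then show ?thesis using *[of "fst p" "snd p" zs] by (cases p) simp
  qed simp
qed

text \<open>A unit here would make \<open>md e\<close> divide the gcd and hence both
  \<open>k\<close> and \<open>l\<close>. This is how non-divisibility enters the area bound.\<close>

lemma root_not_unit:
  assumes "\<not> k dvd l" "\<not> l dvd k" shows "\<not> is_unit (root e)"
proof
  assume "is_unit (root e)"
  then have "md e dvd gcd k l" unfolding md_root by (simp only: mult_unit_dvd_iff dvd_refl)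
  then have "md e dvd k" "md e dvd l" by (auto intro: dvd_trans)
  then show False using assms by (auto simp: md_def split: if_splits)
qed

end

section \<open>Bounding the area by repeated pinching\<close>

text \<open>\<open>K\<close> stands for the relative free group, with \<open>x\<close> its free
  letter and \<open>y\<close> the generator of the factor \<open>H\<close>.\<close>

locale relative_bs = baumslag_solitar +
  fixes K (structure) and h x y
  assumes K: "group_hom K (BS k l) h"
    and x: "x \<in> carrier K" "h x = a" and y: "y \<in> carrier K" "h y = t"
begin

sublocale h: group_hom K "BS k l" h by (rule K)

definition \<rho> where "\<rho> = y \<otimes> x [^] k \<otimes> inv y \<otimes> inv (x [^] l)"

lemma \<rho>_closed [simp]: "\<rho> \<in> carrier K"
  using x y by (simp add: \<rho>_def)

lemma R_closed: "{\<rho>} \<subseteq> carrier K" by simp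

lemma h_\<rho>: "h \<rho> = \<one>\<^bsub>BS k l\<^esub>"
  using bs_relation x y by (simp add: \<rho>_def h.hom_int_pow)

lemma near_relator: "near K {\<rho>} 1 (y \<otimes> x [^] k \<otimes> inv y) (x [^] l)"
  using h.conj_product_1[OF R_closed, of \<one> \<rho>] x y by (simp add: near_def \<rho>_def)

text \<open>For \<open>s = - 1\<close> the relator is read backwards and conjugated by
  \<open>inv y\<close>.\<close>

lemma near_md:
  assumes "s = 1 \<or> s = (- 1 :: int)"
  shows "near K {\<rho>} 1 (y [^] s \<otimes> x [^] md (s \<le> 0) \<otimes> y [^] (- s)) (x [^] md (s > 0))"
proof (cases "s = 1")
  case True
  then show ?thesis using near_relator y by (simp add: md_def h.int_pow_neg)
next
  case False
  then have s: "s = - 1" using assms by simp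
  have "near K {\<rho>} 1 (inv y \<otimes> x [^] l \<otimes> y) (inv y \<otimes> (y \<otimes> x [^] k \<otimes> inv y) \<otimes> y)"
    using y(1) by (intro h.near_lmult[OF R_closed] h.near_rmult[OF R_closed]
        h.near_sym[OF R_closed near_relator]) auto
  then show ?thesis using x y by (simp add: s md_def h.int_pow_neg h.G.m_assoc)
qed

definition area_le where "area_le d w \<longleftrightarrow> (\<exists>j\<le>d. conj_product K {\<rho>} j w)"

lemma area_le_near:
  assumes "near K {\<rho>} c v w" "area_le d w" "c + d \<le> d'" shows "area_le d' v"
proof -
  obtain j where "j \<le> d" "conj_product K {\<rho>} j w" using assms(2) by (auto simp: area_le_def)
  then show ?thesis
    using h.conj_product_near[OF R_closed assms(1)] assms(3)
    by (auto simp: area_le_def intro!: exI[of _ "c + j"])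
qed

text \<open>Progress is lexicographic: if a syllable disappears, the potential may grow. Cost and
  new weight are controlled by the old weight, never by exponents of \<open>t\<close>.\<close>

lemma pinch_step:
  assumes ndvd: "\<not> k dvd l" "\<not> l dvd k"
    and triv: "h (syl K x y xs \<beta>) = \<one>\<^bsub>BS k l\<^esub>" and ne: "syl K x y xs \<beta> \<noteq> \<one>"
  obtains ys \<gamma> c where "near K {\<rho>} c (syl K x y xs \<beta>) (syl K x y ys \<gamma>)" "c \<le> weight xs \<beta>"
    "weight ys \<gamma> \<le> nat (\<bar>k\<bar> + \<bar>l\<bar>) * weight xs \<beta>"
    "length ys < length xs \<or> length ys = length xs \<and> pot ys < pot xs"
proof -
  let ?M = "nat (\<bar>k\<bar> + \<bar>l\<bar>)"
  \<comment> \<open>\<open>?M\<close> bounds both moduli and is at least 1, so the weight bound also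
    covers the steps that do not enlarge any exponent.\<close>
  have M: "w \<le> ?M * w" for w using k by (cases ?M) auto
  show ?thesis
  proof (cases "\<exists>\<alpha>. (\<alpha>, 0) \<in> set xs")
    case True
    then obtain \<alpha> where "(\<alpha>, 0) \<in> set xs" ..
    from h.syl_drop_zero[OF x(1) y(1) this, of \<beta>] obtain ys \<gamma> where
      "syl K x y ys \<gamma> = syl K x y xs \<beta>" "length ys < length xs" "weight ys \<gamma> \<le> weight xs \<beta>" .
    then show ?thesis using that[of 0 ys \<gamma>] x y M[of "weight xs \<beta>"]
      by (simp add: h.near_refl[OF R_closed])
  next
    case False
    have "syl (BS k l) a t xs \<beta> = \<one>\<^bsub>BS k l\<^esub>"
      using triv x y by (simp add: h.hom_syl)
    \<comment> \<open>By Britton's lemma a reduced word representing 1 is empty with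
      \<open>\<beta> = 0\<close>, so its value would be trivial already in \<open>K\<close>.\<close>
    then have "\<not> reduced xs" using britton[of xs \<beta>] ne by auto
    then obtain us \<alpha> m \<alpha>' m' vs where
      xs: "xs = us @ (\<alpha>, m) # (\<alpha>', m') # vs" and m: "m * m' < 0" and "md (m \<le> 0) dvd \<alpha>'"
      using False not_reduced_split[of xs] by metis
    then obtain q where q: "\<alpha>' = md (m \<le> 0) * q" by blast
    show ?thesis
    proof (cases "q = 0")
      case True
      \<comment> \<open>The middle exponent is 0, so the two powers of \<open>t\<close> merge
        without using a relator.\<close>
      then have "syl K x y xs \<beta> = syl K x y (us @ (\<alpha>, m + m') # vs) \<beta>"
        using x y q by (simp add: xs h.syl_append h.int_pow_mult h.G.m_assoc)
      then show ?thesis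
        using that[of 0 "us @ (\<alpha>, m + m') # vs" \<beta>] x y M[of "weight xs \<beta>"] True q
        by (simp add: xs h.near_refl[OF R_closed] weight_append)
    next
      case False
      let ?s = "sgn m" and ?ys = "us @ (\<alpha>, m - sgn m) # (md (m > 0) * q, m' + sgn m) # vs"
      have m0: "m \<noteq> 0" "m' \<noteq> 0" using m by auto
      have s: "?s = 1 \<or> ?s = - 1" "?s \<le> 0 \<longleftrightarrow> m \<le> 0" "?s > 0 \<longleftrightarrow> m > 0"
        using m0 by (auto simp: sgn_if)
      have near: "near K {\<rho>} (nat \<bar>q\<bar>) (syl K x y xs \<beta>) (syl K x y ?ys \<beta>)"
        using h.near_pinch[OF x(1) y(1) R_closed near_md[OF s(1)]] unfolding xs q s(2,3) .
      have "nat \<bar>q\<bar> \<le> nat \<bar>\<alpha>'\<bar>"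
      proof -
        have "1 * \<bar>q\<bar> \<le> \<bar>md (m \<le> 0)\<bar> * \<bar>q\<bar>"
          using md_nonzero[of "m \<le> 0"] by (intro mult_right_mono) linarith+
        then show ?thesis by (simp add: q abs_mult)
      qed
      then have c: "nat \<bar>q\<bar> \<le> weight xs \<beta>" by (simp add: xs weight_append)
      have "nat \<bar>md (m > 0) * q\<bar> \<le> ?M * nat \<bar>\<alpha>'\<bar>"
      proof -
        have "nat \<bar>md (m > 0) * q\<bar> = nat \<bar>md (m > 0)\<bar> * nat \<bar>q\<bar>"
          by (simp add: abs_mult nat_mult_distrib)
        also have "\<dots> \<le> ?M * nat \<bar>\<alpha>'\<bar>"
          using \<open>nat \<bar>q\<bar> \<le> nat \<bar>\<alpha>'\<bar>\<close> by (intro mult_mono) (auto simp: md_def)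
        finally show ?thesis .
      qed
      then have w: "weight ?ys \<beta> \<le> ?M * weight xs \<beta>"
      proof -
        have "weight ?ys \<beta> = weight us 0 + nat \<bar>\<alpha>\<bar> + nat \<bar>md (m > 0) * q\<bar> + weight vs \<beta>"
          by (simp add: weight_append)
        also have "\<dots> \<le> ?M * weight us 0 + ?M * nat \<bar>\<alpha>\<bar> + ?M * nat \<bar>\<alpha>'\<bar> + ?M * weight vs \<beta>"
          using \<open>nat \<bar>md (m > 0) * q\<bar> \<le> ?M * nat \<bar>\<alpha>'\<bar>\<close> by (intro add_mono M)
        also have "\<dots> = ?M * weight xs \<beta>" by (simp add: xs weight_append distrib_left)
        finally show ?thesis .
      qed
      show ?thesis
      proof (cases "m - sgn m = 0 \<or> m' + sgn m = 0")
        case True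
        then obtain \<delta> where "(\<delta>, 0) \<in> set ?ys" by force
        from h.syl_drop_zero[OF x(1) y(1) this, of \<beta>] obtain zs \<gamma> where zs:
          "syl K x y zs \<gamma> = syl K x y ?ys \<beta>" "length zs < length ?ys" "weight zs \<gamma> \<le> weight ?ys \<beta>" .
        then show ?thesis
          using that[of "nat \<bar>q\<bar>" zs \<gamma>] near c w by (simp add: xs)
      next
        case False2: False
        \<comment> \<open>Both exponents have moved by one towards 0 without reaching it, so their
          signs are unchanged.\<close>
        have "m > 0 \<longleftrightarrow> m - sgn m > 0" "m' > 0 \<longleftrightarrow> m' + sgn m > 0"
          using False2 m by (auto simp: sgn_if mult_less_0_iff split: if_splits)
        from pot_pinch[OF root_not_unit[OF ndvd] False this]
        have "pot ?ys < pot xs" unfolding xs q .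
        then show ?thesis using that[OF near c w] by (simp add: xs)
      qed
    qed
  qed
qed

text \<open>The bound is uniform in the exponents of \<open>t\<close>. The outer induction is on the
  number of syllables, the inner one on the potential; each step may multiply the weight by
  \<open>?M\<close>, hence both hold for all \<open>B\<close>.\<close>

lemma area_bound:
  assumes ndvd: "\<not> k dvd l" "\<not> l dvd k"
  shows "\<exists>d. \<forall>xs \<beta>. length xs < r \<and> weight xs \<beta> \<le> B \<and> h (syl K x y xs \<beta>) = \<one>\<^bsub>BS k l\<^esub> \<longrightarrow>
    area_le d (syl K x y xs \<beta>)"
proof (induction r arbitrary: B)
  case (Suc r)
  note outer = this
  let ?M = "nat (\<bar>k\<bar> + \<bar>l\<bar>)"
  have "\<exists>d. \<forall>xs \<beta>. length xs < Suc r \<and> pot xs < s \<and> weight xs \<beta> \<le> B \<and>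
      h (syl K x y xs \<beta>) = \<one>\<^bsub>BS k l\<^esub> \<longrightarrow> area_le d (syl K x y xs \<beta>)" for s B
  proof (induction s arbitrary: B)
    case (Suc s)
    obtain d1 where d1: "\<And>xs \<beta>. length xs < r \<Longrightarrow> weight xs \<beta> \<le> ?M * B \<Longrightarrow>
        h (syl K x y xs \<beta>) = \<one>\<^bsub>BS k l\<^esub> \<Longrightarrow> area_le d1 (syl K x y xs \<beta>)"
      using outer[of "?M * B"] by blast
    obtain d2 where d2: "\<And>xs \<beta>. length xs < Suc r \<Longrightarrow> pot xs < s \<Longrightarrow> weight xs \<beta> \<le> ?M * B \<Longrightarrow>
        h (syl K x y xs \<beta>) = \<one>\<^bsub>BS k l\<^esub> \<Longrightarrow> area_le d2 (syl K x y xs \<beta>)"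
      using Suc.IH[of "?M * B"] by blast
    \<comment> \<open>At most \<open>B\<close> for the step itself, then \<open>d1\<close> if a
      syllable has disappeared and \<open>d2\<close> if the potential has dropped.\<close>
    have "area_le (B + d1 + d2) (syl K x y xs \<beta>)"
      if xs: "length xs < Suc r" "pot xs < Suc s" "weight xs \<beta> \<le> B" "h (syl K x y xs \<beta>) = \<one>\<^bsub>BS k l\<^esub>"
      for xs \<beta>
    proof (cases "syl K x y xs \<beta> = \<one>")
      case True
      then show ?thesis unfolding area_le_def by (intro exI[of _ 0]) (simp add: h.conj_product_0)
    next
      case False
      from pinch_step[OF ndvd xs(4) False] obtain ys \<gamma> c where
        near: "near K {\<rho>} c (syl K x y xs \<beta>) (syl K x y ys \<gamma>)" and c: "c \<le> weight xs \<beta>"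
        and w: "weight ys \<gamma> \<le> ?M * weight xs \<beta>"
        and less: "length ys < length xs \<or> length ys = length xs \<and> pot ys < pot xs" .
      have w: "weight ys \<gamma> \<le> ?M * B" using w xs(3) by (meson le_trans mult_le_mono2)
      have triv: "h (syl K x y ys \<gamma>) = \<one>\<^bsub>BS k l\<^esub>"
        using h.hom_near[OF R_closed _ near] h_\<rho> xs(4) by simp
      have "area_le d1 (syl K x y ys \<gamma>) \<or> area_le d2 (syl K x y ys \<gamma>)"
        using less xs(1,2) d1[OF _ w triv] d2[OF _ _ w triv] by auto
      then show ?thesis
        using area_le_near[OF near, of d1] area_le_near[OF near, of d2] c xs(3) by auto
    qed
    then show ?case by blast
  qed simp
  \<comment> \<open>The potential is at most the weight, so the inner statement for
    \<open>Suc B\<close> covers all words in question.\<close>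
  from this[of "Suc B" B] obtain d where d: "\<And>xs \<beta>. length xs < Suc r \<Longrightarrow> pot xs < Suc B \<Longrightarrow>
      weight xs \<beta> \<le> B \<Longrightarrow> h (syl K x y xs \<beta>) = \<one>\<^bsub>BS k l\<^esub> \<Longrightarrow> area_le d (syl K x y xs \<beta>)" by blast
  have "pot xs < Suc B" if "weight xs \<beta> \<le> B" for xs \<beta>
    using pot_le_weight[OF root_not_unit[OF ndvd], of xs \<beta>] that by simp
  then show ?case using d by blast
qed simp

end

section \<open>The one-relator relative presentation and its Dehn function\<close>

context baumslag_solitar
begin

lemma well_defined:
  assumes ndvd: "\<not> k dvd l" "\<not> l dvd k"
  shows "rel_dehn_well_defined (BS k l) H"
proof -
  interpret relative_group "BS k l" H "{a}"
    by (intro relative_group.intro relative_group_axioms.intro G.is_group subgroup_H) simp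
  have tH: "t [^]\<^bsub>BS k l\<^esub> i \<in> H" for i :: int unfolding H_eq by blast
  have tH1: "t \<in> H" using tH[of 1] by simp
  interpret bs: relative_bs k l P "rel_hom (BS k l)" "gen a" "inc t"
    by unfold_locales (use tH1 in \<open>simp_all add: rel_hom_gen rel_hom_inc\<close>)
  interpret inc: group_hom "(BS k l)\<lparr>carrier := H\<rparr>" P inc
    by (intro group_hom.intro group_hom_axioms.intro inc_hom group_H P.is_group)
  have inc_pow: "inc (t [^]\<^bsub>BS k l\<^esub> i) = inc t [^]\<^bsub>P\<^esub> i" for i :: int
    using inc.hom_int_pow[of t i] tH1 G.int_pow_consistent[OF subgroup_H tH1, of i] by simp
  let ?R = "{bs.\<rho>}"

  \<comment> \<open>The induced map \<open>\<theta>'\<close> is onto and is followed by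
    \<open>rel_hom\<close> to give \<open>proj\<close>, so the kernel of \<open>rel_hom\<close> is
    the image of \<open>N\<close>; this transfers the presentation from \<open>bs_free\<close> to
    \<open>P\<close>.\<close>
  define f where "f = case_bs_gen (gen a) (inc t)"
  have f: "f \<in> UNIV \<rightarrow> carrier P" using tH1 by (auto simp: f_def split: bs_gen.split)
  define \<theta>' where "\<theta>' = free_group_lift P f"
  note \<theta>'_lift = free_group_lift[OF P.is_group f, folded \<theta>'_def]
  interpret \<theta>': group_hom bs_free P \<theta>'
    by (intro group_hom.intro group_hom_axioms.intro \<theta>'_lift(1) P.is_group F.is_group)
  have \<theta>'_gen: "\<theta>' bs_a = gen a" "\<theta>' bs_t = inc t"
    using \<theta>'_lift(2) by (simp_all add: f_def)
  have rel_\<theta>': "rel_hom (BS k l) (\<theta>' w) = proj w" if "w \<in> carrier bs_free" for w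
  proof -
    have "(rel_hom (BS k l) \<circ> \<theta>') w = proj w"
    proof (rule free_group_hom_eqI[OF G.is_group _ proj.homh _ that])
      show "rel_hom (BS k l) \<circ> \<theta>' \<in> hom bs_free (BS k l)"
        using \<theta>'.homh rel.homh by (rule hom_compose)
      show "(rel_hom (BS k l) \<circ> \<theta>') (free_gen UNIV g) = proj (free_gen UNIV g)" for g
        by (cases g) (simp_all add: \<theta>'_gen rel_hom_gen rel_hom_inc tH1)
    qed
    then show ?thesis by simp
  qed
  have \<theta>'_surj: "\<theta>' ` carrier bs_free = carrier P"
  proof (rule rel_free_subgroup_eq)
    show "subgroup (\<theta>' ` carrier bs_free) P" by (rule \<theta>'.img_is_subgroup)
    show "gen ` {a} \<subseteq> \<theta>' ` carrier bs_free"
      using imageI[of bs_a "carrier bs_free" \<theta>'] by (simp add: \<theta>'_gen)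
    have pow: "inc (t [^]\<^bsub>BS k l\<^esub> i) \<in> \<theta>' ` carrier bs_free" for i :: int
      by (rule image_eqI[of _ _ "bs_t [^]\<^bsub>bs_free\<^esub> i"])
        (simp_all add: inc_pow \<theta>'.hom_int_pow \<theta>'_gen)
    show "inc ` H \<subseteq> \<theta>' ` carrier bs_free"
    proof (rule image_subsetI)
      fix g assume "g \<in> H"
      then obtain i :: int where "g = t [^]\<^bsub>BS k l\<^esub> i" using H_eq by blast
      then show "inc g \<in> \<theta>' ` carrier bs_free" using pow by simp
    qed
  qed
  have surj: "rel_hom (BS k l) ` carrier P = carrier (BS k l)"
  proof
    show "carrier (BS k l) \<subseteq> rel_hom (BS k l) ` carrier P"
    proof
      fix g assume "g \<in> carrier (BS k l)"
      then obtain w where w: "w \<in> carrier bs_free" "proj w = g" using proj_surj by blast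
      show "g \<in> rel_hom (BS k l) ` carrier P"
        by (rule image_eqI[of _ _ "\<theta>' w"]) (use w rel_\<theta>' in simp_all)
    qed
  qed (rule image_subsetI, rule rel.hom_closed)
  have relator: "\<theta>' (bs_relator k l) = bs.\<rho>"
    unfolding bs_relator_def Let_def bs.\<rho>_def by (simp add: \<theta>'_gen \<theta>'.hom_int_pow)
  have ker: "normal_closure P ?R = kernel P (BS k l) (rel_hom (BS k l))"
  proof
    show "normal_closure P ?R \<subseteq> kernel P (BS k l) (rel_hom (BS k l))"
      by (rule P.normal_closure_minimal[OF rel.normal_kernel]) (simp add: kernel_def bs.h_\<rho>)
    show "kernel P (BS k l) (rel_hom (BS k l)) \<subseteq> normal_closure P ?R"
    proof
      fix g assume g: "g \<in> kernel P (BS k l) (rel_hom (BS k l))"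
      then have "g \<in> \<theta>' ` carrier bs_free" by (simp add: \<theta>'_surj kernel_def)
      then obtain w where w: "w \<in> carrier bs_free" "g = \<theta>' w" by (elim imageE) simp
      then have "w \<in> N" using g rel_\<theta>'[OF w(1)] by (simp add: kernel_def proj_eq_one_iff)
      then show "g \<in> normal_closure P ?R"
        using lift_normal_closure[OF P.is_group \<theta>'.homh P.normal_closure_normal[OF bs.R_closed]]
          P.normal_closure_superset[of ?R] w(2) by (simp add: relator)
    qed
  qed

  \<comment> \<open>A letter from \<open>H\<close> opens one new syllable with exponent 0 of
    \<open>a\<close>, and a letter from \<open>{a}\<close> only changes the first exponent; so the
    length bounds both the number of syllables and the weight.\<close>
  have word: "\<exists>xs \<beta>. syl P (gen a) (inc t) xs \<beta> = rel_word_value (BS k l) H {a} W \<and>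
      length xs \<le> length W \<and> weight xs \<beta> \<le> length W"
    if "W \<in> lists (rel_alphabet (BS k l) H {a})" for W
    using that
  proof (induction W)
    case Nil
    then show ?case by (intro exI[of _ "[]"] exI[of _ 0]) (simp add: rel_word_value_def)
  next
    case (Cons z W)
    then obtain xs \<beta> where xs: "syl P (gen a) (inc t) xs \<beta> = rel_word_value (BS k l) H {a} W"
      "length xs \<le> length W" "weight xs \<beta> \<le> length W" by auto
    have val: "rel_word_value (BS k l) H {a} (z # W) =
        rel_letter (BS k l) H {a} z \<otimes>\<^bsub>P\<^esub> syl P (gen a) (inc t) xs \<beta>"
      unfolding xs(1) by (simp add: rel_word_value_def)
    have z: "z \<in> rel_alphabet (BS k l) H {a}" using Cons(1) by simp
    show ?case
    proof (cases z)
      case (Inl sb)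
      then have "fst sb = a" using z by (simp add: rel_alphabet_def Plus_def image_iff mem_Times_iff)
      then obtain b where sb: "sb = (a, b)" by (cases sb) simp
      have "rel_letter (BS k l) H {a} z = gen a [^]\<^bsub>P\<^esub> (if b then 1 else - 1 :: int)"
        by (simp add: Inl sb rel_letter_Inl P.int_pow_neg)
      moreover obtain ys \<gamma> where
        "syl P (gen a) (inc t) ys \<gamma> = gen a [^]\<^bsub>P\<^esub> (if b then 1 else - 1 :: int) \<otimes>\<^bsub>P\<^esub> syl P (gen a) (inc t) xs \<beta>"
        "length ys = length xs" "weight ys \<gamma> \<le> nat \<bar>if b then 1 else - 1\<bar> + weight xs \<beta>"
        by (rule P.syl_absorb[OF bs.x(1) bs.y(1)])
      ultimately show ?thesis unfolding val using xs(2,3)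
        by (intro exI[of _ ys] exI[of _ \<gamma>]) (simp split: if_splits)
    next
      case (Inr g)
      then have "g \<in> H" using z by (simp add: rel_alphabet_def Plus_def image_iff)
      then obtain i :: int where "g = t [^]\<^bsub>BS k l\<^esub> i" using H_eq by blast
      then show ?thesis unfolding val using xs(2,3) tH1
        by (intro exI[of _ "(0, i) # xs"] exI[of _ \<beta>]) (simp add: Inr rel_letter_Inr inc_pow)
    qed
  qed

  have "rel_dehn (BS k l) H {a} ?R n \<noteq> \<infinity>" for n
  proof -
    \<comment> \<open>The bound on the number of syllables in \<open>area_bound\<close> is strict,
      whence \<open>Suc n\<close>.\<close>
    obtain d where d: "\<And>xs \<beta>. length xs < Suc n \<Longrightarrow> weight xs \<beta> \<le> n \<Longrightarrow>
        rel_hom (BS k l) (syl P (gen a) (inc t) xs \<beta>) = \<one>\<^bsub>BS k l\<^esub> \<Longrightarrow>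
        bs.area_le d (syl P (gen a) (inc t) xs \<beta>)"
      using bs.area_bound[OF ndvd, of "Suc n" n] by blast
    have "rel_dehn (BS k l) H {a} ?R n \<le> enat d"
      unfolding rel_dehn_def
    proof (rule Least_le, intro ballI impI)
      fix W assume W: "W \<in> lists (rel_alphabet (BS k l) H {a})"
        and 1: "length W \<le> n \<and> rel_hom (BS k l) (rel_word_value (BS k l) H {a} W) = \<one>\<^bsub>BS k l\<^esub>"
      obtain xs \<beta> where "syl P (gen a) (inc t) xs \<beta> = rel_word_value (BS k l) H {a} W"
        "length xs \<le> length W" "weight xs \<beta> \<le> length W" using word[OF W] by blast
      then have "bs.area_le d (rel_word_value (BS k l) H {a} W)"
        using d[of xs \<beta>] 1 by simp
      then show "\<exists>j. enat j \<le> enat d \<and> conj_product P ?R j (rel_word_value (BS k l) H {a} W)"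
        unfolding bs.area_le_def by auto
    qed
    then show ?thesis by (auto dest!: enat_ile)
  qed
  moreover have "finite_rel_presentation (BS k l) H {a} ?R"
    unfolding finite_rel_presentation_def rel_presentation_def generated_rel_def
    using surj ker bs.R_closed S_closed by simp
  ultimately show ?thesis unfolding rel_dehn_well_defined_def by blast
qed

end

theorem theoremA1:
  fixes k l :: int
  assumes "k \<noteq> 0" and "l \<noteq> 0"
  shows "rel_dehn_well_defined (BS k l) (generate (BS k l) {BS_t k l})
           \<longleftrightarrow> \<not> k dvd l \<and> \<not> l dvd k"
proof -
  interpret baumslag_solitar k l by unfold_locales (fact assms)+
  show ?thesis using well_defined not_well_defined by blast
qed

end
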